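(* Let $d \geq 2$ be an integer and let $G$ be a connected graph with $n \geq d+1$ vertices. Then $$a_d(G) \leq a_1(G),$$ where $a_d(G)$ is the generalized algebraic connectivity of $G$ in $\mathbb{R}^d$ and $a_1(G)$ is the (usual) algebraic connectivity of $G$.
   Context: Graphs $G=(V,E)$ are finite, undirected, with no loops or multiple edges, and $V=[n]=\{1,\dots,n\}$. Eigenvalues of a real symmetric matrix are ordered increasingly, $\lambda_1\le\lambda_2\le\cdots$, counted with multiplicity. For $d\ge 1$ and a realization $p=(p_i)_{i\in V}\in\mathbb{R}^{dn}$, with $p_i\in\mathbb{R}^d$, define for each edge $\{i,j\}\in E$ the vector $b_{ij}=(p_i-p_j)/\Vert p_i-p_j\Vert$ if $p_i\neq p_j$, and $b_{ij}=\boldsymbol{0}_d$ otherwise. The rigidity matrix $\mathbf{R}(G,p)\in\mathbb{R}^{|E|\times dn}$ has one row for each edge $\{i,j\}\in E$, equal to $(e_i-e_j)^{\mathsf T}\otimes b_{ij}^{\mathsf T}$, where $\{e_i\}$ is the standard basis of $\mathbb{R}^{n}$ and $\otimes$ is the Kronecker product. The stiffness matrix is $\mathbf{S}(G,p)=\mathbf{R}(G,p)^{\mathsf T}\mathbf{R}(G,p)$. For $d\ge 1$ and $n\ge d+1$, the generalized algebraic connectivity is $$a_d(G)=\sup\Big\{\lambda_{\binom{d+1}{2}+1}(\mathbf{S}(G,p)) : p\in\mathbb{R}^{dn}\Big\}.$$ For $d=1$, $a_1(G)$ coincides with the usual algebraic connectivity $a(G)=\lambda_2(\mathbf{L}(G))$,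 where $\mathbf{L}(G)$ is the graph Laplacian (diagonal entries $\deg(i)$, off-diagonal entries $-1$ if $\{i,j\}\in E$ and $0$ otherwise). *)

theory Defs
  imports
    Complex_Main
    "Jordan_Normal_Form.Char_Poly"
    "Graph_Theory.Pair_Digraph"
    "Graph_Theory.Digraph_Component"
begin

text \<open>
  A finite simple undirected graph is a \<open>pair_graph\<close>, i.e. a finite loop-free symmetric
  digraph without parallel arcs: the edge \<open>{i, j}\<close> is represented by the two arcs
  \<open>(i, j)\<close> and \<open>(j, i)\<close>. Vertices are numbered from \<open>0\<close>, so that they can be used directly
  as matrix and vector indices; all definitions below are meant for graphs \<open>G\<close> with
  \<open>pverts G = {0..<n}\<close>.
\<close>

text \<open>
  \<open>eigval k A\<close> is the \<open>k\<close>-th smallest eigenvalue (counted from \<open>1\<close>) with multiplicity.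
  It is meant for real symmetric \<open>A\<close>, whose characteristic polynomial splits over the reals and
  whose algebraic and geometric multiplicities agree.
\<close>

definition eigval :: "nat \<Rightarrow> real mat \<Rightarrow> real" where
  "eigval k A = sorted_list_of_multiset (proots (char_poly A)) ! (k - 1)"

abbreviation num_verts :: "nat pair_pre_digraph \<Rightarrow> nat" where
  "num_verts G \<equiv> card (pverts G)"

text \<open>Each undirected edge is listed exactly once, as the pair whose first component is smaller.\<close>

definition edge_list :: "nat pair_pre_digraph \<Rightarrow> (nat \<times> nat) list" where
  "edge_list G = filter (\<lambda>(i, j). i < j \<and> (i, j) \<in> parcs G)
     (List.product [0..<num_verts G] [0..<num_verts G])"

text \<open>
  A realization is a vector of dimension \<open>d * n\<close>, and the position of vertex \<open>i\<close> is its \<open>i\<close>-th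
  block of length \<open>d\<close>. This agrees with the block order of the Kronecker product below.
\<close>

definition position :: "nat \<Rightarrow> real vec \<Rightarrow> nat \<Rightarrow> real vec" where
  "position d p i = vec d (\<lambda>k. p $ (i * d + k))"

definition bearing :: "nat \<Rightarrow> real vec \<Rightarrow> nat \<Rightarrow> nat \<Rightarrow> real vec" where
  "bearing d p i j =
     (if position d p i \<noteq> position d p j
      then let u = position d p i - position d p j in (1 / sqrt (u \<bullet> u)) \<cdot>\<^sub>v u
      else 0\<^sub>v d)"

definition kronecker_vec :: "real vec \<Rightarrow> real vec \<Rightarrow> real vec" where
  "kronecker_vec u v =
     vec (dim_vec u * dim_vec v) (\<lambda>k. u $ (k div dim_vec v) * v $ (k mod dim_vec v))"

text \<open>
  The row of an edge does not depend on its orientation, since exchanging \<open>i\<close> and \<open>j\<close> changes the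
  sign of both Kronecker factors. The order of the rows does not affect the stiffness matrix.
\<close>

definition rigidity_matrix :: "nat \<Rightarrow> nat pair_pre_digraph \<Rightarrow> real vec \<Rightarrow> real mat" where
  "rigidity_matrix d G p =
     mat_of_rows (d * num_verts G)
       (map (\<lambda>(i, j). kronecker_vec
               (unit_vec (num_verts G) i - unit_vec (num_verts G) j) (bearing d p i j))
            (edge_list G))"

definition stiffness_matrix :: "nat \<Rightarrow> nat pair_pre_digraph \<Rightarrow> real vec \<Rightarrow> real mat" where
  "stiffness_matrix d G p = transpose_mat (rigidity_matrix d G p) * rigidity_matrix d G p"

text \<open>
  The supremum is one of a nonempty set that is bounded above (by the trace bound
  \<open>2 * length (edge_list G)\<close>) whenever \<open>d \<ge> 1\<close> and \<open>num_verts G \<ge> d + 1\<close>, so \<open>Sup\<close> on the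
  reals has its usual meaning.
\<close>

definition gen_alg_connectivity :: "nat \<Rightarrow> nat pair_pre_digraph \<Rightarrow> real" where
  "gen_alg_connectivity d G =
     Sup {eigval (((d + 1) choose 2) + 1) (stiffness_matrix d G p) | p.
            p \<in> carrier_vec (d * num_verts G)}"

definition laplacian_matrix :: "nat pair_pre_digraph \<Rightarrow> real mat" where
  "laplacian_matrix G =
     mat (num_verts G) (num_verts G)
       (\<lambda>(i, j). if i = j then real (out_degree (with_proj G) i)
                 else if (i, j) \<in> parcs G then - 1 else 0)"

definition alg_connectivity :: "nat pair_pre_digraph \<Rightarrow> real" where
  "alg_connectivity G = eigval 2 (laplacian_matrix G)"

end

theory Submission
  imports Defs
begin

text \<open>
  The quadratic form of \<open>stiffness_matrix d G p\<close> sends a displacement field \<open>x\<close>, with values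
  \<open>x\<^sub>i \<in> \<real>\<^sup>d\<close>, to the sum of \<open>(b\<^sub>i\<^sub>j \<bullet> (x\<^sub>i - x\<^sub>j))\<^sup>2\<close> over the edges.
  By the min-max principle it suffices to exhibit, for every realization \<open>p\<close>,
  \<open>((d + 1) choose 2) + 1\<close> nonzero fields that are orthogonal for the inner product and for this
  form, and whose Rayleigh quotients are at most the algebraic connectivity \<open>\<alpha>\<close>
  (\<open>eigval_le_if_orthogonal_test_vectors\<close>).

  If the points span \<open>\<real>\<^sup>d\<close> affinely, the infinitesimal rigid motions supply
  \<open>(d + 1) choose 2\<close> such fields, all with quotient \<open>0\<close>. The remaining field is \<open>x\<^sub>i = v\<^sub>i u\<close>, where
  \<open>v\<close> is a Fiedler vector of the Laplacian and \<open>u = (\<Sum>i. v\<^sub>i p\<^sub>i)\<close> (any \<open>u\<close> will do if this sum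
  is zero). It is orthogonal to the translations because \<open>v\<close> is orthogonal to the constants, and
  orthogonal to the rotation \<open>x\<^sub>i = A p\<^sub>i\<close>, \<open>A\<close> skew-symmetric, because the inner product is
  \<open>u \<bullet> A u = 0\<close>. Since bearings have length at most one, \<open>(b\<^sub>i\<^sub>j \<bullet> u)\<^sup>2 \<le> u \<bullet> u\<close>, so its energy is at
  most \<open>u \<bullet> u\<close> times the Laplacian energy of \<open>v\<close>, that is, at most \<open>\<alpha>\<close> times its squared norm.

  Working in the principal axes of the point set (\<open>principal_frame\<close>) makes the rigid motions
  mutually orthogonal, and it also settles the degenerate case: along an axis on which all points
  have the same coordinate every field has zero energy, and there are \<open>n \<ge> d + 1\<close> independent
  ones. They replace the translation along this axis and the rotations that involve it, and leave
  at least one to spare, which takes the place of the field built from \<open>v\<close>.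

  The resulting bound \<open>eigval_stiffness_le_alg_connectivity\<close> holds for every \<open>d \<ge> 1\<close>. For
  \<open>d = 1\<close> and pairwise distinct points the stiffness matrix is the Laplacian, so the bound is
  attained and the supremum defining \<open>gen_alg_connectivity 1 G\<close> equals \<open>alg_connectivity G\<close>.
\<close>

section \<open>Spectral theory of real symmetric matrices\<close>

lemma scalar_prod_self_nonneg: "0 \<le> (v :: real vec) \<bullet> v"
  by (auto simp: scalar_prod_def intro: sum_nonneg)

lemma scalar_prod_self_eq_0_iff:
  assumes "(v :: real vec) \<in> carrier_vec n"
  shows "v \<bullet> v = 0 \<longleftrightarrow> v = 0\<^sub>v n"
  using assms by (auto simp: scalar_prod_def sum_nonneg_eq_0_iff)

lemma scalar_prod_self_pos:
  assumes "(v :: real vec) \<in> carrier_vec n" "v \<noteq> 0\<^sub>v n"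
  shows "0 < v \<bullet> v"
  using scalar_prod_self_nonneg[of v] scalar_prod_self_eq_0_iff[OF assms(1)] assms(2) by linarith

lemma symmetric_scalar_prod:
  fixes A :: "real mat"
  assumes A: "A \<in> carrier_mat n n" "A\<^sup>T = A" and x: "x \<in> carrier_vec n" and y: "y \<in> carrier_vec n"
  shows "x \<bullet> (A *\<^sub>v y) = (A *\<^sub>v x) \<bullet> y"
  using transpose_vec_mult_scalar[OF A(1) y x] A(2) by simp

text \<open>
  An eigenvector over the complex numbers splits as \<open>a + \<i> b\<close>. Comparing \<open>b \<bullet> A a\<close> with
  \<open>A b \<bullet> a\<close> shows that its eigenvalue is real, and then \<open>a\<close> or \<open>b\<close> is a real eigenvector.
\<close>

lemma symmetric_real_eigenpair:
  fixes A :: "real mat"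
  assumes A: "A \<in> carrier_mat n n" "A\<^sup>T = A" and n: "n > 0"
  shows "\<exists>v e. v \<in> carrier_vec n \<and> v \<bullet> v = 1 \<and> A *\<^sub>v v = e \<cdot>\<^sub>v v"
proof -
  define B where "B = map_mat complex_of_real A"
  have B: "B \<in> carrier_mat n n" using A by (simp add: B_def)
  obtain as where as: "char_poly B = (\<Prod> a \<leftarrow> as. [:- a, 1:])" "length as = n"
    using char_poly_factorized[OF B] by blast
  then obtain z as' where "as = z # as'" using n by (cases as) auto
  hence "poly (char_poly B) z = 0" using as by simp
  hence "eigenvalue B z" using eigenvalue_root_char_poly[OF B] by blast
  then obtain x where x: "x \<in> carrier_vec n" "x \<noteq> 0\<^sub>v n" "B *\<^sub>v x = z \<cdot>\<^sub>v x"
    using B unfolding eigenvalue_def eigenvector_def by auto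
  define a where "a = map_vec Re x"
  define b where "b = map_vec Im x"
  have ab: "a \<in> carrier_vec n" "b \<in> carrier_vec n" using x by (auto simp: a_def b_def)
  have row: "row B i \<bullet> x = z * x $ i" if "i < n" for i
    using arg_cong[OF x(3), of "\<lambda>y. y $ i"] that B x(1) by simp
  have ReB: "row A i \<bullet> a = Re (row B i \<bullet> x)" and ImB: "row A i \<bullet> b = Im (row B i \<bullet> x)" if "i < n" for i
    using that A x(1) by (auto simp: scalar_prod_def B_def a_def b_def)
  have idx: "a $ i = Re (x $ i)" "b $ i = Im (x $ i)" if "i < n" for i
    using that x(1) by (auto simp: a_def b_def)
  have Aa: "A *\<^sub>v a = Re z \<cdot>\<^sub>v a - Im z \<cdot>\<^sub>v b"
    using A x(1) ab by (intro eq_vecI) (auto simp: ReB row idx)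
  have Ab: "A *\<^sub>v b = Im z \<cdot>\<^sub>v a + Re z \<cdot>\<^sub>v b"
    using A x(1) ab by (intro eq_vecI) (auto simp: ImB row idx)
  have pos: "a \<bullet> a + b \<bullet> b > 0"
  proof -
    have "a \<noteq> 0\<^sub>v n \<or> b \<noteq> 0\<^sub>v n"
    proof (rule ccontr)
      assume "\<not> ?thesis"
      hence 0: "a = 0\<^sub>v n" "b = 0\<^sub>v n" by auto
      have "x $ i = 0" if "i < n" for i
        using arg_cong[OF 0(1), of "\<lambda>y. y $ i"] arg_cong[OF 0(2), of "\<lambda>y. y $ i"] that x(1)
        by (auto simp: a_def b_def complex_eq_iff)
      hence "x = 0\<^sub>v n" using x(1) by (intro eq_vecI) auto
      thus False using x(2) by simp
    qed
    thus ?thesis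
      using scalar_prod_self_pos ab scalar_prod_self_nonneg[of a] scalar_prod_self_nonneg[of b]
      by (smt (verit))
  qed
  have com: "a \<bullet> b = b \<bullet> a" using comm_scalar_prod ab by blast
  have "b \<bullet> (A *\<^sub>v a) = (A *\<^sub>v b) \<bullet> a" by (rule symmetric_scalar_prod[OF A ab(2) ab(1)])
  hence "Re z * (b \<bullet> a) - Im z * (b \<bullet> b) = Im z * (a \<bullet> a) + Re z * (b \<bullet> a)"
    unfolding Aa Ab using ab
    by (simp add: scalar_prod_minus_distrib[where n = n] add_scalar_prod_distrib[where n = n])
  hence "Im z * (a \<bullet> a + b \<bullet> b) = 0" by (simp add: algebra_simps)
  hence z: "Im z = 0" using pos by simp
  have eig: "A *\<^sub>v a = Re z \<cdot>\<^sub>v a" "A *\<^sub>v b = Re z \<cdot>\<^sub>v b"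
    unfolding Aa Ab z using ab by auto
  have "a \<bullet> a > 0 \<or> b \<bullet> b > 0"
    using pos by linarith
  then obtain y where y: "y \<in> carrier_vec n" "A *\<^sub>v y = Re z \<cdot>\<^sub>v y" "y \<bullet> y > 0"
    using eig ab by blast
  define c where "c = 1 / sqrt (y \<bullet> y)"
  have c: "c * (c * (y \<bullet> y)) = 1" using y(3) by (simp add: c_def field_simps)
  have "A *\<^sub>v (c \<cdot>\<^sub>v y) = Re z \<cdot>\<^sub>v (c \<cdot>\<^sub>v y)"
    using mult_mat_vec[OF A(1) y(1)] y by (simp add: smult_smult_assoc mult.commute)
  moreover have "(c \<cdot>\<^sub>v y) \<bullet> (c \<cdot>\<^sub>v y) = 1" using y(1) c by simp
  ultimately show ?thesis using y(1) by (meson smult_carrier_vec)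
qed

text \<open>
  \<open>H\<close> is the reflection in the hyperplane orthogonal to \<open>v - e\<^sub>0\<close>. If \<open>v = e\<^sub>0\<close>, the coefficient
  \<open>c\<close> below is \<open>2 / 0 = 0\<close> and the same formula gives the identity.
\<close>

lemma householder_reflection:
  fixes v :: "real vec"
  assumes v: "v \<in> carrier_vec n" "v \<bullet> v = 1" and n: "n > 0"
  shows "\<exists>H. H \<in> carrier_mat n n \<and> H\<^sup>T = H \<and> (\<forall>x \<in> carrier_vec n. H *\<^sub>v (H *\<^sub>v x) = x)
    \<and> H *\<^sub>v v = unit_vec n 0"
proof -
  define e :: "real vec" where "e = unit_vec n 0"
  have e: "e \<in> carrier_vec n" "e \<bullet> e = 1" using n by (auto simp: e_def)
  define w where "w = v - e"
  have w: "w \<in> carrier_vec n" using v e by (simp add: w_def)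
  define c where "c = 2 / (w \<bullet> w)"
  define H where "H = mat n n (\<lambda>(i, j). (if i = j then 1 else 0) - c * w $ i * w $ j)"
  have H: "H \<in> carrier_mat n n" by (simp add: H_def)
  have HT: "H\<^sup>T = H" by (rule eq_matI) (auto simp: H_def)
  have Hx: "H *\<^sub>v x = x - (c * (w \<bullet> x)) \<cdot>\<^sub>v w" if x: "x \<in> carrier_vec n" for x
  proof (rule eq_vecI)
    fix i assume "i < dim_vec (x - (c * (w \<bullet> x)) \<cdot>\<^sub>v w)"
    hence i: "i < n" using w by simp
    have "(H *\<^sub>v x) $ i = (\<Sum>j = 0..<n. ((if i = j then 1 else 0) - c * w $ i * w $ j) * x $ j)"
      using i x by (simp add: H_def scalar_prod_def)
    also have "\<dots> = (\<Sum>j = 0..<n. (if i = j then x $ j else 0)) - (\<Sum>j = 0..<n. c * w $ i * (w $ j * x $ j))"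
      unfolding sum_subtractf[symmetric] by (intro sum.cong) (auto simp: algebra_simps)
    also have "\<dots> = x $ i - c * w $ i * (w \<bullet> x)"
      using i x by (simp add: scalar_prod_def sum_distrib_left)
    finally show "(H *\<^sub>v x) $ i = (x - (c * (w \<bullet> x)) \<cdot>\<^sub>v w) $ i" using i w x by simp
  qed (use w H in auto)
  have cww: "c * (w \<bullet> w) = 2 \<or> w = 0\<^sub>v n"
    using scalar_prod_self_eq_0_iff[OF w] by (auto simp: c_def)
  have HH: "H *\<^sub>v (H *\<^sub>v x) = x" if x: "x \<in> carrier_vec n" for x
  proof -
    have "w \<bullet> (H *\<^sub>v x) = w \<bullet> x - c * (w \<bullet> w) * (w \<bullet> x)"
      unfolding Hx[OF x] using w x by (simp add: scalar_prod_minus_distrib[where n = n])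
    hence "c * (w \<bullet> (H *\<^sub>v x)) = c * (w \<bullet> x) - c * (w \<bullet> w) * (c * (w \<bullet> x))"
      by (simp add: right_diff_distrib mult_ac)
    hence 1: "c * (w \<bullet> (H *\<^sub>v x)) = - (c * (w \<bullet> x)) \<or> w = 0\<^sub>v n"
      using cww by auto
    have "H *\<^sub>v x \<in> carrier_vec n" using H x by simp
    note H2 = Hx[OF this]
    show ?thesis
      using 1
    proof
      assume "c * (w \<bullet> (H *\<^sub>v x)) = - (c * (w \<bullet> x))"
      thus ?thesis unfolding H2 using x w by (intro eq_vecI) (auto simp: Hx[OF x])
    next
      assume "w = 0\<^sub>v n"
      thus ?thesis unfolding H2 using x w by (intro eq_vecI) (auto simp: Hx[OF x])
    qed
  qed
  have "H *\<^sub>v v = e"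
  proof -
    have ve: "e \<bullet> v = v \<bullet> e" using comm_scalar_prod v e by blast
    have wv: "w \<bullet> v = 1 - v \<bullet> e" unfolding w_def using v e ve
      by (simp add: minus_scalar_prod_distrib[where n = n])
    have "w \<bullet> w = 2 - 2 * (v \<bullet> e)" unfolding w_def using v e ve
      by (simp add: minus_scalar_prod_distrib[where n = n] scalar_prod_minus_distrib[where n = n])
    hence "w \<bullet> w = 2 * (w \<bullet> v)" using wv by simp
    hence "c * (w \<bullet> v) = 1 \<or> w = 0\<^sub>v n"
      using cww by auto
    thus ?thesis
    proof
      assume "c * (w \<bullet> v) = 1"
      thus ?thesis using Hx[OF v(1)] v e by (auto simp: w_def intro!: eq_vecI)
    next
      assume w0: "w = 0\<^sub>v n"
      have "v $ i = e $ i" if "i < n" for i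
        using arg_cong[OF w0, of "\<lambda>y. y $ i"] that v e by (simp add: w_def)
      thus ?thesis using Hx[OF v(1)] v e w0 by (auto intro!: eq_vecI)
    qed
  qed
  thus ?thesis using H HT HH by (auto simp: e_def)
qed

text \<open>
  Deflation: a reflection \<open>H\<close> that moves a unit eigenvector \<open>v\<close> to the first basis vector turns
  \<open>A\<close> into \<open>H A H\<close>, whose first row and column vanish off the diagonal. An eigenbasis of the
  remaining block, padded with a leading zero and reflected back, completes \<open>v\<close>.
\<close>

lemma symmetric_orthonormal_eigenbasis:
  fixes A :: "real mat"
  assumes "A \<in> carrier_mat n n" "A\<^sup>T = A"
  shows "\<exists>u e. (\<forall>i<n. u i \<in> carrier_vec n \<and> A *\<^sub>v u i = e i \<cdot>\<^sub>v u i)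
    \<and> (\<forall>i<n. \<forall>j<n. u i \<bullet> u j = (if i = j then 1 else 0))"
  using assms
proof (induction n arbitrary: A)
  case 0
  thus ?case by simp
next
  case (Suc n)
  note A = Suc.prems
  obtain v e0 where v: "v \<in> carrier_vec (Suc n)" "v \<bullet> v = 1" "A *\<^sub>v v = e0 \<cdot>\<^sub>v v"
    using symmetric_real_eigenpair[OF A] by auto
  obtain H where H: "H \<in> carrier_mat (Suc n) (Suc n)" "H\<^sup>T = H"
    and HH: "\<And>x. x \<in> carrier_vec (Suc n) \<Longrightarrow> H *\<^sub>v (H *\<^sub>v x) = x"
    and Hv: "H *\<^sub>v v = unit_vec (Suc n) 0"
    using householder_reflection[OF v(1,2)] by auto
  define K where "K = H * A * H"
  have K: "K \<in> carrier_mat (Suc n) (Suc n)" using H A by (auto simp: K_def)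
  have KT: "K\<^sup>T = K"
  proof -
    have "K\<^sup>T = H\<^sup>T * (H * A)\<^sup>T"
      unfolding K_def by (rule transpose_mult) (use H A in auto)
    also have "(H * A)\<^sup>T = A\<^sup>T * H\<^sup>T" by (rule transpose_mult) (use H A in auto)
    also have "H\<^sup>T * (A\<^sup>T * H\<^sup>T) = K"
      unfolding K_def using H A by (simp add: assoc_mult_mat[OF H(1) A(1) H(1)])
    finally show ?thesis .
  qed
  have Kx: "K *\<^sub>v x = H *\<^sub>v (A *\<^sub>v (H *\<^sub>v x))" if x: "x \<in> carrier_vec (Suc n)" for x
    unfolding K_def using H A x
    by (simp add: assoc_mult_mat_vec[of _ "Suc n" "Suc n" _ "Suc n"])
  have Hunit: "H *\<^sub>v unit_vec (Suc n) 0 = v" using HH[OF v(1)] Hv by simp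
  have Kunit: "K *\<^sub>v unit_vec (Suc n) 0 = e0 \<cdot>\<^sub>v unit_vec (Suc n) 0"
    using Kx[of "unit_vec (Suc n) 0"] Hunit v Hv mult_mat_vec[OF H(1) v(1)] by simp
  have Hprod: "(H *\<^sub>v x) \<bullet> (H *\<^sub>v y) = x \<bullet> y"
    if "x \<in> carrier_vec (Suc n)" "y \<in> carrier_vec (Suc n)" for x y
    using symmetric_scalar_prod[OF H, of "H *\<^sub>v x" y] that HH[of x] H by simp
  define B where "B = mat n n (\<lambda>(i, j). K $$ (Suc i, Suc j))"
  have B: "B \<in> carrier_mat n n" by (simp add: B_def)
  have BT: "B\<^sup>T = B"
  proof (rule eq_matI)
    fix i j assume "i < dim_row B" "j < dim_col B"
    hence ij: "i < n" "j < n" by (auto simp: B_def)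
    have "K\<^sup>T $$ (Suc i, Suc j) = K $$ (Suc j, Suc i)" using ij K by simp
    thus "B\<^sup>T $$ (i, j) = B $$ (i, j)" using ij KT by (simp add: B_def)
  qed (auto simp: B_def)
  have Ky: "K *\<^sub>v vCons 0 y = vCons 0 (B *\<^sub>v y)" if y: "y \<in> carrier_vec n" for y
  proof (rule eq_vecI)
    fix i assume "i < dim_vec (vCons 0 (B *\<^sub>v y))"
    hence i: "i < Suc n" using B by simp
    show "(K *\<^sub>v vCons 0 y) $ i = vCons 0 (B *\<^sub>v y) $ i"
    proof (cases i)
      case 0
      have "(K *\<^sub>v vCons 0 y) $ 0 = (K *\<^sub>v vCons 0 y) \<bullet> unit_vec (Suc n) 0"
        using K y by simp
      also have "\<dots> = vCons 0 y \<bullet> (K *\<^sub>v unit_vec (Suc n) 0)"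
        using symmetric_scalar_prod[OF K KT] y by simp
      also have "\<dots> = 0" unfolding Kunit using y by simp
      finally show ?thesis using 0 by simp
    next
      case (Suc k)
      have "(K *\<^sub>v vCons 0 y) $ i = (\<Sum>j = 0..<Suc n. K $$ (i, j) * vCons 0 y $ j)"
        using i K y by (simp add: scalar_prod_def)
      also have "\<dots> = (\<Sum>j = 0..<n. K $$ (i, Suc j) * y $ j)"
        by (subst sum.atLeast0_lessThan_Suc_shift) simp
      also have "\<dots> = (B *\<^sub>v y) $ k"
        using i Suc y by (simp add: B_def scalar_prod_def)
      finally show ?thesis using Suc by simp
    qed
  qed (use K B in auto)
  obtain w f where w: "\<And>i. i < n \<Longrightarrow> w i \<in> carrier_vec n" "\<And>i. i < n \<Longrightarrow> B *\<^sub>v w i = f i \<cdot>\<^sub>v w i"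
      "\<And>i j. i < n \<Longrightarrow> j < n \<Longrightarrow> w i \<bullet> w j = (if i = j then 1 else 0)"
    using Suc.IH[OF B BT] by metis
  define y where "y i = (case i of 0 \<Rightarrow> unit_vec (Suc n) 0 | Suc k \<Rightarrow> vCons 0 (w k))" for i
  define e where "e i = (case i of 0 \<Rightarrow> e0 | Suc k \<Rightarrow> f k)" for i
  have y: "y i \<in> carrier_vec (Suc n)" if "i < Suc n" for i
    using that w by (auto simp: y_def split: nat.split)
  have Kyi: "K *\<^sub>v y i = e i \<cdot>\<^sub>v y i" if "i < Suc n" for i
    using that w Kunit by (auto simp: y_def e_def Ky vec_index_vCons split: nat.split intro!: eq_vecI)
  have yy: "y i \<bullet> y j = (if i = j then 1 else 0)" if "i < Suc n" "j < Suc n" for i j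
    using that w by (auto simp: y_def split: nat.split)
  show ?case
  proof (intro exI[of _ "\<lambda>i. H *\<^sub>v y i"] exI[of _ e] conjI allI impI)
    fix i assume i: "i < Suc n"
    show "H *\<^sub>v y i \<in> carrier_vec (Suc n)" using H y i by simp
    have "H *\<^sub>v (K *\<^sub>v y i) = A *\<^sub>v (H *\<^sub>v y i)"
      unfolding Kx[OF y[OF i]] by (rule HH) (use H A y[OF i] in auto)
    thus "A *\<^sub>v (H *\<^sub>v y i) = e i \<cdot>\<^sub>v (H *\<^sub>v y i)"
      unfolding Kyi[OF i] using mult_mat_vec[OF H(1) y[OF i]] by simp
    fix j assume "j < Suc n"
    thus "(H *\<^sub>v y i) \<bullet> (H *\<^sub>v y j) = (if i = j then 1 else 0)"
      using Hprod y i yy by simp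
  qed
qed

lemma sorted_orthonormal_eigenbasis:
  fixes A :: "real mat"
  assumes A: "A \<in> carrier_mat n n" "A\<^sup>T = A"
  obtains u e where
    "\<And>i. i < n \<Longrightarrow> u i \<in> carrier_vec n"
    "\<And>i. i < n \<Longrightarrow> A *\<^sub>v u i = e i \<cdot>\<^sub>v u i"
    "\<And>i j. i < n \<Longrightarrow> j < n \<Longrightarrow> u i \<bullet> u j = (if i = j then 1 else 0)"
    "\<And>i j. i \<le> j \<Longrightarrow> j < n \<Longrightarrow> e i \<le> e j"
proof -
  obtain u0 e0 where u0: "\<forall>i<n. u0 i \<in> carrier_vec n \<and> A *\<^sub>v u0 i = e0 i \<cdot>\<^sub>v u0 i"
    "\<forall>i<n. \<forall>j<n. u0 i \<bullet> u0 j = (if i = j then 1 else (0::real))"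
    using symmetric_orthonormal_eigenbasis[OF A] by blast
  define js where "js = sort_key e0 [0..<n]"
  have len: "length js = n" and dist: "distinct js" and set: "set js = {0..<n}"
    by (auto simp: js_def)
  have sorted: "sorted (map e0 js)" by (simp add: js_def)
  have lt: "js ! i < n" if "i < n" for i using that len set nth_mem[of i js] by auto
  show ?thesis
  proof (rule that[of "\<lambda>i. u0 (js ! i)" "\<lambda>i. e0 (js ! i)"])
    fix i j assume "i \<le> j" "j < n"
    thus "e0 (js ! i) \<le> e0 (js ! j)" using sorted_nth_mono[OF sorted, of i j] len by simp
  qed (use u0 lt len dist in \<open>auto simp: nth_eq_iff_index_eq\<close>)
qed

lemma diagonalisation:
  fixes A :: "real mat"
  assumes A: "A \<in> carrier_mat n n"
    and u: "\<And>i. i < n \<Longrightarrow> u i \<in> carrier_vec n"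
      "\<And>i. i < n \<Longrightarrow> A *\<^sub>v u i = e i \<cdot>\<^sub>v u i"
      "\<And>i j. i < n \<Longrightarrow> j < n \<Longrightarrow> u i \<bullet> u j = (if i = j then 1 else 0)"
  defines "Q \<equiv> mat n n (\<lambda>(i, j). u j $ i)"
  shows "Q * Q\<^sup>T = 1\<^sub>m n" "Q\<^sup>T * Q = 1\<^sub>m n" "A = Q * mat_diag n e * Q\<^sup>T"
proof -
  have Q: "Q \<in> carrier_mat n n" by (simp add: Q_def)
  have colQ: "col Q j = u j" if "j < n" for j
    using that u(1)[OF that] by (intro eq_vecI) (auto simp: Q_def)
  show QQ: "Q\<^sup>T * Q = 1\<^sub>m n"
    using Q u(3) by (intro eq_matI) (auto simp: colQ)
  show QQ': "Q * Q\<^sup>T = 1\<^sub>m n"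
    by (rule mat_mult_left_right_inverse[OF _ Q QQ]) (use Q in simp)
  have "A * Q = Q * mat_diag n e"
  proof (subst mat_diag_mult_right[OF Q], rule eq_matI)
    fix i j assume "i < dim_row (mat n n (\<lambda>(i, j). Q $$ (i, j) * e j))"
      "j < dim_col (mat n n (\<lambda>(i, j). Q $$ (i, j) * e j))"
    hence ij: "i < n" "j < n" by auto
    have "(A * Q) $$ (i, j) = (A *\<^sub>v u j) $ i" using ij A Q by (simp add: colQ)
    also have "\<dots> = e j * u j $ i" using ij u(1)[OF ij(2)] by (simp add: u(2))
    finally show "(A * Q) $$ (i, j) = mat n n (\<lambda>(i, j). Q $$ (i, j) * e j) $$ (i, j)"
      using ij by (simp add: Q_def)
  qed (use A Q in auto)
  hence "Q * mat_diag n e * Q\<^sup>T = A * (Q * Q\<^sup>T)"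
    using assoc_mult_mat[OF A Q, of "Q\<^sup>T" n] Q by simp
  thus "A = Q * mat_diag n e * Q\<^sup>T" using QQ' A by simp
qed

lemma eigval_eigenbasis:
  fixes A :: "real mat"
  assumes A: "A \<in> carrier_mat n n"
    and u: "\<And>i. i < n \<Longrightarrow> u i \<in> carrier_vec n"
      "\<And>i. i < n \<Longrightarrow> A *\<^sub>v u i = e i \<cdot>\<^sub>v u i"
      "\<And>i j. i < n \<Longrightarrow> j < n \<Longrightarrow> u i \<bullet> u j = (if i = j then 1 else 0)"
    and sorted: "\<And>i j. i \<le> j \<Longrightarrow> j < n \<Longrightarrow> e i \<le> e j"
    and k: "k < n"
  shows "eigval (Suc k) A = e k"
proof -
  define Q where "Q = mat n n (\<lambda>(i, j). u j $ i)"
  note diag = diagonalisation[OF A u, folded Q_def]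
  have Q: "Q \<in> carrier_mat n n" by (simp add: Q_def)
  have D: "mat_diag n e \<in> carrier_mat n n" by simp
  have "similar_mat A (mat_diag n e)"
    by (rule similar_matI[of _ _ Q "Q\<^sup>T" n]) (use diag A Q in auto)
  hence "char_poly A = char_poly (mat_diag n e)" by (rule char_poly_similar)
  also have "\<dots> = (\<Prod>a\<leftarrow>diag_mat (mat_diag n e). [:- a, 1:])"
    by (rule char_poly_upper_triangular[OF D]) (auto simp: upper_triangular_def mat_diag_def)
  also have "diag_mat (mat_diag n e) = map e [0..<n]"
    by (auto simp: diag_mat_def mat_diag_def)
  finally have cp: "char_poly A = (\<Prod>a\<leftarrow>map e [0..<n]. [:- a, 1:])" .
  have "proots (char_poly A) = (\<Sum>p\<leftarrow>map (\<lambda>a. [:- a, 1:]) (map e [0..<n]). proots p)"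
  proof -
    have "0 \<notin> set (map (\<lambda>a. [:- a, 1:]) (map e [0..<n]))" by auto
    from proots_prod_list[OF this] show ?thesis unfolding cp by simp
  qed
  also have "\<dots> = (\<Sum>a\<leftarrow>map e [0..<n]. {#a#})" by (simp add: o_def)
  also have "\<dots> = mset (map e [0..<n])"
    by (induction n) simp_all
  finally have roots: "proots (char_poly A) = mset (map e [0..<n])" .
  have "sorted_list_of_multiset (proots (char_poly A)) = sort (map e [0..<n])"
    unfolding roots by (rule sorted_list_of_multiset_mset)
  also have "\<dots> = map e [0..<n]"
    by (rule sorted_sort_id) (auto simp: sorted_iff_nth_mono intro: sorted)
  finally show ?thesis using k by (simp add: eigval_def)
qed

text \<open>
  Parseval's identity and its weighted version: both sides are computed from the coordinates
  \<open>Q\<^sup>T x\<close> in the eigenbasis.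
\<close>

lemma quadratic_form_eigenbasis:
  fixes A :: "real mat"
  assumes A: "A \<in> carrier_mat n n"
    and u: "\<And>i. i < n \<Longrightarrow> u i \<in> carrier_vec n"
      "\<And>i. i < n \<Longrightarrow> A *\<^sub>v u i = e i \<cdot>\<^sub>v u i"
      "\<And>i j. i < n \<Longrightarrow> j < n \<Longrightarrow> u i \<bullet> u j = (if i = j then 1 else 0)"
    and x: "x \<in> carrier_vec n"
  shows "x \<bullet> x = (\<Sum>i<n. (u i \<bullet> x)\<^sup>2)" "x \<bullet> (A *\<^sub>v x) = (\<Sum>i<n. e i * (u i \<bullet> x)\<^sup>2)"
proof -
  define Q where "Q = mat n n (\<lambda>(i, j). u j $ i)"
  note diag = diagonalisation[OF A u, folded Q_def]
  have Q: "Q \<in> carrier_mat n n" by (simp add: Q_def)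
  define D where "D = mat_diag n e"
  have D: "D \<in> carrier_mat n n" by (simp add: D_def)
  define y where "y = Q\<^sup>T *\<^sub>v x"
  have y: "y \<in> carrier_vec n" using Q x by (simp add: y_def)
  have yi: "y $ i = u i \<bullet> x" if "i < n" for i
  proof -
    have "col Q i = u i" using that u(1)[OF that] by (intro eq_vecI) (auto simp: Q_def)
    thus ?thesis using that Q by (simp add: y_def)
  qed
  have xQ: "x \<bullet> (Q *\<^sub>v z) = y \<bullet> z" if "z \<in> carrier_vec n" for z
    unfolding y_def using transpose_vec_mult_scalar[OF Q that x] by simp
  have Qy: "Q *\<^sub>v y = x"
    unfolding y_def using Q x diag(1) by (simp add: assoc_mult_mat_vec[symmetric, of _ n n _ n])
  show "x \<bullet> x = (\<Sum>i<n. (u i \<bullet> x)\<^sup>2)"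
    using xQ[OF y] y unfolding Qy
    by (simp add: scalar_prod_def yi power2_eq_square atLeast0LessThan)
  have Ax: "A *\<^sub>v x = Q *\<^sub>v (D *\<^sub>v y)"
  proof -
    have "A *\<^sub>v x = (Q * D * Q\<^sup>T) *\<^sub>v x" using diag(3) by (simp add: D_def)
    thus ?thesis unfolding y_def using Q D x by (simp add: assoc_mult_mat_vec[of _ n n _ n])
  qed
  have Dy: "(D *\<^sub>v y) $ i = e i * y $ i" if "i < n" for i
  proof -
    have "(D *\<^sub>v y) $ i = (\<Sum>j = 0..<n. if i = j then e i * y $ j else 0)"
      using that y by (simp add: D_def mat_diag_def scalar_prod_def if_distrib[of "\<lambda>c. c * _"] cong: if_cong)
    thus ?thesis using that by simp
  qed
  show "x \<bullet> (A *\<^sub>v x) = (\<Sum>i<n. e i * (u i \<bullet> x)\<^sup>2)"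
    unfolding Ax using D y xQ[of "D *\<^sub>v y"]
    by (auto simp: scalar_prod_def Dy yi power2_eq_square atLeast0LessThan simp del: index_mult_mat_vec intro!: sum.cong)
qed

text \<open>
  The upper half of the min-max principle, for a test space given by a basis that is orthogonal
  with respect to both the inner product and the form of \<open>A\<close>. The span of \<open>k + 1\<close> test vectors
  contains a nonzero vector \<open>x\<close> orthogonal to the first \<open>k\<close> eigenvectors; if the next
  eigenvalue exceeded \<open>c\<close>, then so would the Rayleigh quotient of \<open>x\<close>.
\<close>

lemma eigval_le_if_orthogonal_test_vectors:
  fixes A :: "real mat"
  assumes A: "A \<in> carrier_mat n n" "A\<^sup>T = A"
    and k: "k < n"
    and w: "\<And>i. i \<le> k \<Longrightarrow> w i \<in> carrier_vec n"
    and pos: "\<And>i. i \<le> k \<Longrightarrow> w i \<bullet> w i > 0"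
    and orth: "\<And>i j. i \<le> k \<Longrightarrow> j \<le> k \<Longrightarrow> i \<noteq> j \<Longrightarrow> w i \<bullet> w j = 0"
    and Aorth: "\<And>i j. i \<le> k \<Longrightarrow> j \<le> k \<Longrightarrow> i \<noteq> j \<Longrightarrow> w i \<bullet> (A *\<^sub>v w j) = 0"
    and bound: "\<And>i. i \<le> k \<Longrightarrow> w i \<bullet> (A *\<^sub>v w i) \<le> c * (w i \<bullet> w i)"
  shows "eigval (Suc k) A \<le> c"
proof (rule ccontr)
  obtain u e where u: "\<And>i. i < n \<Longrightarrow> u i \<in> carrier_vec n"
    "\<And>i. i < n \<Longrightarrow> A *\<^sub>v u i = e i \<cdot>\<^sub>v u i"
    "\<And>i j. i < n \<Longrightarrow> j < n \<Longrightarrow> u i \<bullet> u j = (if i = j then 1 else 0)"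
    and sorted: "\<And>i j. i \<le> j \<Longrightarrow> j < n \<Longrightarrow> e i \<le> e j"
    using sorted_orthonormal_eigenbasis[OF A] by blast
  assume "\<not> ?thesis"
  hence c: "e k > c" using eigval_eigenbasis[OF A(1) u sorted k] by simp
  define W where "W = mat n (Suc k) (\<lambda>(i, j). w j $ i)"
  have W: "W \<in> carrier_mat n (Suc k)" by (simp add: W_def)
  have colW: "col W i = w i" if "i \<le> k" for i
    using that w[OF that] by (intro eq_vecI) (auto simp: W_def)
  \<comment> \<open>The zero row \<open>k\<close> makes the system of \<open>k\<close> equations square and hence singular.\<close>
  define B where "B = mat (Suc k) (Suc k) (\<lambda>(i, j). if i < k then u i \<bullet> w j else 0)"
  have B: "B \<in> carrier_mat (Suc k) (Suc k)" by (simp add: B_def)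
  have "row B k = 0\<^sub>v (Suc k)" by (intro eq_vecI) (auto simp: B_def)
  hence "B = mat\<^sub>r (Suc k) (Suc k) (\<lambda>i. if i = k then 0\<^sub>v (Suc k) else row B i)"
    by (intro eq_rowI) (auto simp: B_def)
  moreover have "det (mat\<^sub>r (Suc k) (Suc k) (\<lambda>i. if i = k then 0\<^sub>v (Suc k) else row B i)) = 0"
    by (rule det_row_0) (use B in auto)
  ultimately have "det B = 0" by simp
  then obtain a where a: "a \<in> carrier_vec (Suc k)" "a \<noteq> 0\<^sub>v (Suc k)" "B *\<^sub>v a = 0\<^sub>v (Suc k)"
    using det_0_iff_vec_prod_zero[OF B] by blast
  define x where "x = W *\<^sub>v a"
  have x: "x \<in> carrier_vec n" using W a by (simp add: x_def)
  have dot: "y \<bullet> x = (\<Sum>j\<le>k. a $ j * (y \<bullet> w j))" if y: "y \<in> carrier_vec n" for y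
  proof -
    have "y \<bullet> x = (W\<^sup>T *\<^sub>v y) \<bullet> a"
      unfolding x_def using transpose_vec_mult_scalar[OF W a(1) y] by simp
    also have "\<dots> = (\<Sum>j\<le>k. (w j \<bullet> y) * a $ j)"
      using W a(1) by (simp add: scalar_prod_def[of _ a] colW atLeast0LessThan lessThan_Suc_atMost del: sum.op_ivl_Suc)
    also have "\<dots> = (\<Sum>j\<le>k. a $ j * (y \<bullet> w j))"
      using comm_scalar_prod[OF y w] by (intro sum.cong) auto
    finally show ?thesis .
  qed
  have ux: "u i \<bullet> x = 0" if i: "i < k" for i
  proof -
    have "u i \<bullet> x = (\<Sum>j\<le>k. a $ j * (u i \<bullet> w j))" using dot u(1) i k by simp
    also have "\<dots> = (B *\<^sub>v a) $ i"
      using i B a(1) by (simp add: scalar_prod_def[of _ a] B_def atLeast0LessThan lessThan_Suc_atMost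
          mult.commute del: sum.op_ivl_Suc)
    also have "\<dots> = 0" using a(3) i by simp
    finally show ?thesis .
  qed
  have form: "x \<bullet> (M *\<^sub>v x) = (\<Sum>j\<le>k. (a $ j)\<^sup>2 * (w j \<bullet> (M *\<^sub>v w j)))"
    if M: "M \<in> carrier_mat n n" "M\<^sup>T = M"
      "\<And>i j. i \<le> k \<Longrightarrow> j \<le> k \<Longrightarrow> i \<noteq> j \<Longrightarrow> w i \<bullet> (M *\<^sub>v w j) = 0" for M
  proof -
    have "x \<bullet> (M *\<^sub>v x) = (M *\<^sub>v x) \<bullet> x"
      by (rule symmetric_scalar_prod[OF M(1,2) x x])
    also have "\<dots> = (\<Sum>j\<le>k. a $ j * ((M *\<^sub>v x) \<bullet> w j))"
      by (rule dot) (use M x in simp)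
    also have "\<dots> = (\<Sum>j\<le>k. (a $ j)\<^sup>2 * (w j \<bullet> (M *\<^sub>v w j)))"
    proof (rule sum.cong[OF refl])
      fix j assume j: "j \<in> {..k}"
      have Mw: "M *\<^sub>v w j \<in> carrier_vec n" using M w j by simp
      have "(M *\<^sub>v x) \<bullet> w j = x \<bullet> (M *\<^sub>v w j)"
        using symmetric_scalar_prod[OF M(1,2) x w[of j]] j by simp
      also have "\<dots> = (M *\<^sub>v w j) \<bullet> x" by (rule comm_scalar_prod[OF x Mw])
      also have "\<dots> = (\<Sum>i\<le>k. a $ i * ((M *\<^sub>v w j) \<bullet> w i))" by (rule dot[OF Mw])
      also have "\<dots> = (\<Sum>i\<le>k. if i = j then a $ j * (w j \<bullet> (M *\<^sub>v w j)) else 0)"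
        using j M(3)[of _ j] comm_scalar_prod[OF Mw w] by (intro sum.cong) auto
      also have "\<dots> = a $ j * (w j \<bullet> (M *\<^sub>v w j))" using j by simp
      finally show "a $ j * ((M *\<^sub>v x) \<bullet> w j) = (a $ j)\<^sup>2 * (w j \<bullet> (M *\<^sub>v w j))"
        by (simp add: power2_eq_square)
    qed
    finally show ?thesis .
  qed
  have xx: "x \<bullet> x = (\<Sum>j\<le>k. (a $ j)\<^sup>2 * (w j \<bullet> w j))"
    using form[of "1\<^sub>m n"] x w orth by simp
  obtain j where j: "j \<le> k" "a $ j \<noteq> 0"
  proof (rule ccontr)
    assume "\<not> thesis"
    hence "a = 0\<^sub>v (Suc k)" using that a(1) by (intro eq_vecI) (auto simp: less_Suc_eq_le)
    thus False using a(2) by simp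
  qed
  have xpos: "x \<bullet> x > 0"
    unfolding xx by (rule sum_pos2[of _ j]) (use j pos in \<open>auto simp: scalar_prod_self_nonneg\<close>)
  have xAx: "x \<bullet> (A *\<^sub>v x) = (\<Sum>j\<le>k. (a $ j)\<^sup>2 * (w j \<bullet> (A *\<^sub>v w j)))"
    by (rule form[OF A Aorth])
  have upper: "x \<bullet> (A *\<^sub>v x) \<le> c * (x \<bullet> x)"
    unfolding xAx xx sum_distrib_left
  proof (rule sum_mono)
    fix i assume "i \<in> {..k}"
    hence "(a $ i)\<^sup>2 * (w i \<bullet> (A *\<^sub>v w i)) \<le> (a $ i)\<^sup>2 * (c * (w i \<bullet> w i))"
      by (intro mult_left_mono bound) auto
    thus "(a $ i)\<^sup>2 * (w i \<bullet> (A *\<^sub>v w i)) \<le> c * ((a $ i)\<^sup>2 * (w i \<bullet> w i))"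
      by (simp add: mult_ac)
  qed
  have "(\<Sum>i<n. e k * (u i \<bullet> x)\<^sup>2) \<le> (\<Sum>i<n. e i * (u i \<bullet> x)\<^sup>2)"
  proof (rule sum_mono)
    fix i assume i: "i \<in> {..<n}"
    show "e k * (u i \<bullet> x)\<^sup>2 \<le> e i * (u i \<bullet> x)\<^sup>2"
      by (cases "i < k") (use ux sorted[of k i] i in \<open>auto intro: mult_right_mono\<close>)
  qed
  hence "e k * (x \<bullet> x) \<le> x \<bullet> (A *\<^sub>v x)"
    by (simp only: quadratic_form_eigenbasis[OF A(1) u x] sum_distrib_left)
  with upper have "e k * (x \<bullet> x) \<le> c * (x \<bullet> x)" by linarith
  thus False using c xpos by simp
qed

text \<open>
  The plane spanned by the first two eigenvectors contains a nonzero vector orthogonal to \<open>z\<close>.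
  For the Laplacian and the all-ones vector \<open>z\<close> this yields what is needed of a Fiedler vector
  even when the eigenvalue \<open>0\<close> is multiple.
\<close>

lemma eigval_2_test_vector:
  fixes A :: "real mat"
  assumes A: "A \<in> carrier_mat n n" "A\<^sup>T = A" and n: "2 \<le> n" and z: "z \<in> carrier_vec n"
  obtains v where "v \<in> carrier_vec n" "v \<bullet> v > 0" "v \<bullet> z = 0"
    "v \<bullet> (A *\<^sub>v v) \<le> eigval 2 A * (v \<bullet> v)"
proof -
  obtain u e where u: "\<And>i. i < n \<Longrightarrow> u i \<in> carrier_vec n"
    "\<And>i. i < n \<Longrightarrow> A *\<^sub>v u i = e i \<cdot>\<^sub>v u i"
    "\<And>i j. i < n \<Longrightarrow> j < n \<Longrightarrow> u i \<bullet> u j = (if i = j then 1 else 0)"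
    and sorted: "\<And>i j. i \<le> j \<Longrightarrow> j < n \<Longrightarrow> e i \<le> e j"
    using sorted_orthonormal_eigenbasis[OF A] by blast
  have e1: "eigval 2 A = e 1"
    using eigval_eigenbasis[OF A(1) u sorted, of 1] n by (simp add: numeral_2_eq_2)
  have u01: "u 0 \<in> carrier_vec n" "u 1 \<in> carrier_vec n" "u 0 \<bullet> u 0 = 1" "u 1 \<bullet> u 1 = 1"
    "u 0 \<bullet> u 1 = 0" "u 1 \<bullet> u 0 = 0" using n u by auto
  obtain a b where ab: "a * (u 0 \<bullet> z) + b * (u 1 \<bullet> z) = 0" "a\<^sup>2 + b\<^sup>2 > 0"
  proof (cases "u 0 \<bullet> z = 0")
    case True
    thus ?thesis using that[of 1 0] by simp
  next
    case False
    thus ?thesis using that[of "- (u 1 \<bullet> z)" "u 0 \<bullet> z"] by (simp add: sum_power2_gt_zero_iff)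
  qed
  define v where "v = a \<cdot>\<^sub>v u 0 + b \<cdot>\<^sub>v u 1"
  have v: "v \<in> carrier_vec n" using u01 by (simp add: v_def)
  have vz: "v \<bullet> z = 0"
    using ab(1) u01 z by (simp add: v_def add_scalar_prod_distrib[where n = n])
  have vv: "v \<bullet> v = a\<^sup>2 + b\<^sup>2"
    using u01 by (simp add: v_def add_scalar_prod_distrib[where n = n]
        scalar_prod_add_distrib[where n = n] power2_eq_square)
  have "(\<Sum>i<n. e i * (u i \<bullet> v)\<^sup>2) \<le> (\<Sum>i<n. e 1 * (u i \<bullet> v)\<^sup>2)"
  proof (rule sum_mono)
    fix i assume i: "i \<in> {..<n}"
    show "e i * (u i \<bullet> v)\<^sup>2 \<le> e 1 * (u i \<bullet> v)\<^sup>2"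
    proof (cases "i \<le> 1")
      case True
      thus ?thesis using sorted[of i 1] n by (auto intro: mult_right_mono)
    next
      case False
      hence "u i \<bullet> v = 0" using i n u(1)[of i] u(3)[of i] u01
        by (simp add: v_def scalar_prod_add_distrib[where n = n])
      thus ?thesis by simp
    qed
  qed
  hence "v \<bullet> (A *\<^sub>v v) \<le> e 1 * (v \<bullet> v)"
    by (simp only: quadratic_form_eigenbasis[OF A(1) u v] sum_distrib_left)
  thus ?thesis using that[OF v] vz vv ab(2) e1 by simp
qed

lemma eigval_nonneg:
  fixes A :: "real mat"
  assumes A: "A \<in> carrier_mat n n" "A\<^sup>T = A" and k: "k < n"
    and psd: "\<And>x. x \<in> carrier_vec n \<Longrightarrow> 0 \<le> x \<bullet> (A *\<^sub>v x)"
  shows "0 \<le> eigval (Suc k) A"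
proof -
  obtain u e where u: "\<And>i. i < n \<Longrightarrow> u i \<in> carrier_vec n"
    "\<And>i. i < n \<Longrightarrow> A *\<^sub>v u i = e i \<cdot>\<^sub>v u i"
    "\<And>i j. i < n \<Longrightarrow> j < n \<Longrightarrow> u i \<bullet> u j = (if i = j then 1 else 0)"
    and sorted: "\<And>i j. i \<le> j \<Longrightarrow> j < n \<Longrightarrow> e i \<le> e j"
    using sorted_orthonormal_eigenbasis[OF A] by blast
  have "u k \<bullet> (A *\<^sub>v u k) = e k" using u k by simp
  thus ?thesis using psd[OF u(1)[OF k]] eigval_eigenbasis[OF A(1) u sorted k] by simp
qed

section \<open>The stiffness matrix as a quadratic form\<close>

definition edges :: "nat pair_pre_digraph \<Rightarrow> (nat \<times> nat) set" where
  "edges G = {(i, j). i < j \<and> j < num_verts G \<and> (i, j) \<in> parcs G}"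

lemma set_edge_list: "set (edge_list G) = edges G"
  by (auto simp: edge_list_def edges_def)

lemma distinct_edge_list: "distinct (edge_list G)"
  by (simp add: edge_list_def distinct_product)

lemma finite_edges: "finite (edges G)"
  using set_edge_list[of G] by (metis List.finite_set)

lemma dim_bearing: "bearing d p i j \<in> carrier_vec d"
  by (auto simp: bearing_def position_def Let_def)

definition edge_row :: "nat \<Rightarrow> nat \<Rightarrow> real vec \<Rightarrow> nat \<times> nat \<Rightarrow> real vec" where
  "edge_row d n p = (\<lambda>(i, j). kronecker_vec (unit_vec n i - unit_vec n j) (bearing d p i j))"

lemma edge_row_carrier: "edge_row d n p e \<in> carrier_vec (d * n)"
  using dim_bearing[of d p "fst e" "snd e"]
  by (auto simp: edge_row_def kronecker_vec_def mult.commute split: prod.split)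

lemma rigidity_matrix_carrier:
  "rigidity_matrix d G p \<in> carrier_mat (length (edge_list G)) (d * num_verts G)"
  by (simp add: rigidity_matrix_def mat_of_rows_def)

lemma stiffness_matrix_carrier:
  "stiffness_matrix d G p \<in> carrier_mat (d * num_verts G) (d * num_verts G)"
  using rigidity_matrix_carrier[of d G p] by (simp add: stiffness_matrix_def)

lemma stiffness_matrix_symmetric: "(stiffness_matrix d G p)\<^sup>T = stiffness_matrix d G p"
  unfolding stiffness_matrix_def
  by (subst transpose_mult[OF _ rigidity_matrix_carrier]) (use rigidity_matrix_carrier in auto)

lemma stiffness_matrix_bilinear:
  assumes x: "x \<in> carrier_vec (d * num_verts G)" and y: "y \<in> carrier_vec (d * num_verts G)"
  shows "x \<bullet> (stiffness_matrix d G p *\<^sub>v y) =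
    (\<Sum>e\<in>edges G. (edge_row d (num_verts G) p e \<bullet> x) * (edge_row d (num_verts G) p e \<bullet> y))"
proof -
  define R where "R = rigidity_matrix d G p"
  define es where "es = edge_list G"
  have R: "R \<in> carrier_mat (length es) (d * num_verts G)"
    using rigidity_matrix_carrier[of d G p] by (simp add: R_def es_def)
  have RT: "R\<^sup>T \<in> carrier_mat (d * num_verts G) (length es)" using R by simp
  have Ry: "R *\<^sub>v y \<in> carrier_vec (length es)" using R y by simp
  have row: "(R *\<^sub>v z) $ r = edge_row d (num_verts G) p (es ! r) \<bullet> z" if "r < length es" for r z
  proof -
    have "row R r = edge_row d (num_verts G) p (es ! r)"
      unfolding R_def rigidity_matrix_def
      using that edge_row_carrier[of d "num_verts G" p "es ! r"]
      by (subst mat_of_rows_row) (auto simp: es_def edge_row_def)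
    thus ?thesis using that R by simp
  qed
  have "x \<bullet> (stiffness_matrix d G p *\<^sub>v y) = x \<bullet> (R\<^sup>T *\<^sub>v (R *\<^sub>v y))"
    unfolding stiffness_matrix_def R_def[symmetric] by (simp only: assoc_mult_mat_vec[OF RT R y])
  also have "\<dots> = (R *\<^sub>v x) \<bullet> (R *\<^sub>v y)"
    using transpose_vec_mult_scalar[OF RT Ry x] by simp
  also have "\<dots> = (\<Sum>r<length es. (edge_row d (num_verts G) p (es ! r) \<bullet> x)
      * (edge_row d (num_verts G) p (es ! r) \<bullet> y))"
    using R by (simp add: scalar_prod_def[of "R *\<^sub>v x"] row atLeast0LessThan del: index_mult_mat_vec)
  also have "\<dots> = (\<Sum>e\<leftarrow>es. (edge_row d (num_verts G) p e \<bullet> x) * (edge_row d (num_verts G) p e \<bullet> y))"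
    by (simp add: sum_list_sum_nth atLeast0LessThan)
  also have "\<dots> = (\<Sum>e\<in>edges G. (edge_row d (num_verts G) p e \<bullet> x) * (edge_row d (num_verts G) p e \<bullet> y))"
    unfolding es_def by (simp add: sum_list_distinct_conv_sum_set distinct_edge_list set_edge_list)
  finally show ?thesis .
qed

text \<open>
  Coincident endpoints are the case \<open>c = 0\<close>, so that no later argument has to single them out.
\<close>

lemma bearing_scaled:
  obtains c where "bearing d p i j = c \<cdot>\<^sub>v (position d p i - position d p j)"
    "c\<^sup>2 * ((position d p i - position d p j) \<bullet> (position d p i - position d p j)) \<le> 1"
proof (cases "position d p i = position d p j")
  case True
  have "bearing d p i j = 0 \<cdot>\<^sub>v (position d p i - position d p j)"
    using True by (auto simp: bearing_def position_def)
  thus ?thesis using that[of 0] by simp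
next
  case False
  define y where "y = position d p i - position d p j"
  have "y \<bullet> y \<ge> 0" by (rule scalar_prod_self_nonneg)
  hence "(1 / sqrt (y \<bullet> y))\<^sup>2 * (y \<bullet> y) \<le> 1" by (simp add: power_divide)
  moreover have "bearing d p i j = (1 / sqrt (y \<bullet> y)) \<cdot>\<^sub>v y"
    using False by (simp add: bearing_def y_def Let_def)
  ultimately show ?thesis using that unfolding y_def by blast
qed

lemma sum_div_mod:
  fixes f :: "nat \<Rightarrow> nat \<Rightarrow> real"
  shows "(\<Sum>k<d * n. f (k div d) (k mod d)) = (\<Sum>i<n. \<Sum>a<d. f i a)"
proof -
  have "(\<Sum>k<n * d. f (k div d) (k mod d)) = (\<Sum>i<n. \<Sum>k = i * d..<i * d + d. f (k div d) (k mod d))"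
    by (rule sum.nat_group[symmetric])
  also have "\<dots> = (\<Sum>i<n. \<Sum>a<d. f i a)"
  proof (rule sum.cong[OF refl])
    fix i
    have "(\<Sum>k = i * d..<i * d + d. f (k div d) (k mod d))
        = (\<Sum>a = 0..<d. f ((a + i * d) div d) ((a + i * d) mod d))"
      using sum.shift_bounds_nat_ivl[of "\<lambda>k. f (k div d) (k mod d)" 0 "i * d" d] by (simp add: add.commute)
    also have "\<dots> = (\<Sum>a<d. f i a)" by (simp add: atLeast0LessThan)
    finally show "(\<Sum>k = i * d..<i * d + d. f (k div d) (k mod d)) = (\<Sum>a<d. f i a)" .
  qed
  finally show ?thesis by (simp add: mult.commute)
qed

section \<open>The Laplacian as a stiffness matrix\<close>

lemma edge_row_1:
  assumes ij: "i < n" "j < n" "p $ i \<noteq> p $ j"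
  obtains b where "b * b = 1" "edge_row 1 n p (i, j) = b \<cdot>\<^sub>v (unit_vec n i - unit_vec n j)"
proof -
  define b where "b = bearing 1 p i j $ 0"
  have "position 1 p i \<noteq> position 1 p j"
    using ij(3) by (metis (no_types, lifting) position_def index_vec less_one add_0_right mult_1_right)
  hence "b = (p $ i - p $ j) / sqrt ((p $ i - p $ j) * (p $ i - p $ j))"
    by (simp add: b_def bearing_def position_def Let_def scalar_prod_def)
  hence "b * b = 1" using ij(3) by simp
  moreover have "dim_vec (bearing 1 p i j) = 1" using dim_bearing[of 1 p i j] by simp
  hence "edge_row 1 n p (i, j) = b \<cdot>\<^sub>v (unit_vec n i - unit_vec n j)"
    using ij by (intro eq_vecI) (auto simp: edge_row_def kronecker_vec_def b_def)
  ultimately show ?thesis using that by blast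
qed

text \<open>
  On a line, distinct points have bearings \<open>\<plusminus> 1\<close>, and the sign disappears in products of entries of
  one row.
\<close>

lemma laplacian_eq_stiffness_matrix:
  assumes G: "pair_graph G" and V: "pverts G = {0..<n}" and inj: "inj_on (\<lambda>i. p $ i) {..<n}"
  shows "laplacian_matrix G = stiffness_matrix 1 G p"
proof (rule eq_matI)
  interpret pair_graph G by (rule G)
  have n: "num_verts G = n" by (simp add: V)
  have carr: "stiffness_matrix 1 G p \<in> carrier_mat n n"
    using stiffness_matrix_carrier[of 1 G p] by (simp add: n)
  have E: "i < j" "j < n" "i < n" "(i, j) \<in> parcs G" if "(i, j) \<in> edges G" for i j
    using that by (auto simp: edges_def n)
  have sym: "(j, i) \<in> parcs G" if "(i, j) \<in> parcs G" for i j
    using that graph_symmetric by blast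
  have in_V: "i < n" "j < n" if "(i, j) \<in> parcs G" for i j
    using that wellformed[of "(i, j)"] V by auto
  have loop: "i \<noteq> j" if "(i, j) \<in> parcs G" for i j
    using no_loops[OF that] by simp
  define \<delta> where "\<delta> i k = (if i = k then 1 else 0 :: real)" for i k :: nat
  fix k l assume "k < dim_row (stiffness_matrix 1 G p)" "l < dim_col (stiffness_matrix 1 G p)"
  hence kl: "k < n" "l < n" using carr by auto
  have "stiffness_matrix 1 G p $$ (k, l)
      = unit_vec n k \<bullet> (stiffness_matrix 1 G p *\<^sub>v unit_vec n l)"
    using kl carr by simp
  also have "\<dots> = (\<Sum>e\<in>edges G. (edge_row 1 n p e $ k) * (edge_row 1 n p e $ l))"
    using stiffness_matrix_bilinear[of "unit_vec n k" 1 G "unit_vec n l" p]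
      edge_row_carrier[of 1 n p] kl by (simp add: n)
  also have "\<dots> = (\<Sum>(i, j)\<in>edges G. (\<delta> i k - \<delta> j k) * (\<delta> i l - \<delta> j l))"
  proof (rule sum.cong[OF refl], clarify)
    fix i j assume "(i, j) \<in> edges G"
    note ij = E[OF this]
    have "p $ i \<noteq> p $ j" using inj ij by (auto simp: inj_on_def)
    then obtain b where b: "b * b = 1"
      and "edge_row 1 n p (i, j) = b \<cdot>\<^sub>v (unit_vec n i - unit_vec n j)"
      using edge_row_1 ij by blast
    hence row: "edge_row 1 n p (i, j) $ m = (\<delta> i m - \<delta> j m) * b" if "m < n" for m
      using that ij by (simp add: \<delta>_def unit_vec_def)
    have "edge_row 1 n p (i, j) $ k * edge_row 1 n p (i, j) $ l
        = (\<delta> i k - \<delta> j k) * (\<delta> i l - \<delta> j l) * (b * b)"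
      using row kl by simp
    thus "edge_row 1 n p (i, j) $ k * edge_row 1 n p (i, j) $ l = (\<delta> i k - \<delta> j k) * (\<delta> i l - \<delta> j l)"
      using b by simp
  qed
  also have "\<dots> = laplacian_matrix G $$ (k, l)"
  proof (cases "k = l")
    case True
    let ?A = "{(i, j) \<in> edges G. i = k}" and ?B = "{(i, j) \<in> edges G. j = k}"
    have "(\<Sum>(i, j)\<in>edges G. (\<delta> i k - \<delta> j k) * (\<delta> i l - \<delta> j l))
        = (\<Sum>e\<in>edges G. (if e \<in> ?A then 1 else 0) + (if e \<in> ?B then 1 else 0))"
    proof (rule sum.cong[OF refl], clarify)
      fix i j assume ij: "(i, j) \<in> edges G"
      show "(\<delta> i k - \<delta> j k) * (\<delta> i l - \<delta> j l)
          = (if (i, j) \<in> ?A then 1 else 0) + (if (i, j) \<in> ?B then 1 else 0)"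
        using E(1)[OF ij] ij True by (auto simp: \<delta>_def)
    qed
    also have "\<dots> = real (card ?A + card ?B)"
    proof -
      have "(\<Sum>e\<in>edges G. if e \<in> A then 1 else 0) = real (card A)" if "A \<subseteq> edges G" for A
        using that finite_edges[of G] by (simp add: sum.If_cases Int_absorb1)
      note count = this
      have "?A \<subseteq> edges G" "?B \<subseteq> edges G" by auto
      thus ?thesis by (simp only: sum.distrib count of_nat_add)
    qed
    also have "card ?A + card ?B = card {e \<in> parcs G. fst e = k}"
    proof -
      have "card ?B = card (prod.swap ` ?B)" by (rule card_image[symmetric]) simp
      moreover have "card ?A + card (prod.swap ` ?B) = card (?A \<union> prod.swap ` ?B)"
      proof (rule card_Un_disjoint[symmetric])
        show "finite ?A" "finite (prod.swap ` ?B)"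
          using finite_edges[of G] by (auto intro: finite_subset[of _ "edges G"])
        show "?A \<inter> prod.swap ` ?B = {}"
        proof (rule ccontr)
          assume "?A \<inter> prod.swap ` ?B \<noteq> {}"
          then obtain m where "(k, m) \<in> edges G" "(m, k) \<in> edges G" by auto
          thus False using E(1)[of k m] E(1)[of m k] by simp
        qed
      qed
      moreover have "?A \<union> prod.swap ` ?B = {e \<in> parcs G. fst e = k}"
      proof (intro equalityI subsetI)
        fix e assume "e \<in> {e \<in> parcs G. fst e = k}"
        then obtain m where e: "e = (k, m)" "(k, m) \<in> parcs G" by (cases e) auto
        have "(k, m) \<in> edges G \<or> (m, k) \<in> edges G"
          using e(2) sym[OF e(2)] loop[OF e(2)] in_V[OF e(2)] by (auto simp: edges_def n)
        thus "e \<in> ?A \<union> prod.swap ` ?B" using e(1) by force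
      qed (auto intro: E(4) sym[OF E(4)])
      ultimately show ?thesis by simp
    qed
    also have "real \<dots> = laplacian_matrix G $$ (k, l)"
      using True kl by (simp add: laplacian_matrix_def n out_degree_def out_arcs_def)
    finally show ?thesis .
  next
    case False
    have "(\<Sum>(i, j)\<in>edges G. (\<delta> i k - \<delta> j k) * (\<delta> i l - \<delta> j l))
        = (\<Sum>e\<in>edges G. if e = (min k l, max k l) then - 1 else 0)"
      using False E(1) by (intro sum.cong) (force simp: \<delta>_def min_def max_def)+
    also have "\<dots> = (if (min k l, max k l) \<in> edges G then - 1 else 0)"
      using finite_edges[of G] by simp
    also have "\<dots> = laplacian_matrix G $$ (k, l)"
      using False kl sym[of k l] sym[of l k]
      by (auto simp: laplacian_matrix_def n edges_def min_def max_def)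
    finally show ?thesis .
  qed
  finally show "laplacian_matrix G $$ (k, l) = stiffness_matrix 1 G p $$ (k, l)" by simp
next
  have n: "num_verts G = n" by (simp add: V)
  show "dim_row (laplacian_matrix G) = dim_row (stiffness_matrix 1 G p)"
    "dim_col (laplacian_matrix G) = dim_col (stiffness_matrix 1 G p)"
    using stiffness_matrix_carrier[of 1 G p] by (auto simp: laplacian_matrix_def n)
qed


lemma laplacian_quadratic_form:
  assumes G: "pair_graph G" and V: "pverts G = {0..<n}" and x: "x \<in> carrier_vec n"
  shows "x \<bullet> (laplacian_matrix G *\<^sub>v x) = (\<Sum>(i, j)\<in>edges G. (x $ i - x $ j)\<^sup>2)"
proof -
  define p where "p = vec n real"
  have inj: "inj_on (\<lambda>i. p $ i) {..<n}" by (auto simp: inj_on_def p_def)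
  have n: "num_verts G = n" by (simp add: V)
  have "x \<bullet> (laplacian_matrix G *\<^sub>v x)
      = (\<Sum>e\<in>edges G. (edge_row 1 n p e \<bullet> x) * (edge_row 1 n p e \<bullet> x))"
    unfolding laplacian_eq_stiffness_matrix[OF G V inj]
    using stiffness_matrix_bilinear[of x 1 G x p] x by (simp add: n)
  also have "\<dots> = (\<Sum>(i, j)\<in>edges G. (x $ i - x $ j)\<^sup>2)"
  proof (rule sum.cong[OF refl], clarify)
    fix i j assume "(i, j) \<in> edges G"
    hence ij: "i < j" "i < n" "j < n" by (auto simp: edges_def n)
    hence "p $ i \<noteq> p $ j" by (simp add: p_def)
    then obtain b where b: "b * b = 1"
      and row: "edge_row 1 n p (i, j) = b \<cdot>\<^sub>v (unit_vec n i - unit_vec n j)"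
      using edge_row_1 ij by blast
    have "edge_row 1 n p (i, j) \<bullet> x = b * (x $ i - x $ j)"
      unfolding row using x ij by (simp add: minus_scalar_prod_distrib[where n = n])
    hence "(edge_row 1 n p (i, j) \<bullet> x) * (edge_row 1 n p (i, j) \<bullet> x) = (b * b) * (x $ i - x $ j)\<^sup>2"
      by (simp add: power2_eq_square)
    thus "(edge_row 1 n p (i, j) \<bullet> x) * (edge_row 1 n p (i, j) \<bullet> x) = (x $ i - x $ j)\<^sup>2"
      using b by simp
  qed
  finally show ?thesis .
qed

lemma laplacian_symmetric:
  assumes G: "pair_graph G" and V: "pverts G = {0..<n}"
  shows "laplacian_matrix G \<in> carrier_mat n n" "(laplacian_matrix G)\<^sup>T = laplacian_matrix G"
proof -
  have "inj_on (\<lambda>i. vec n real $ i) {..<n}" by (auto simp: inj_on_def)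
  note L = laplacian_eq_stiffness_matrix[OF G V this]
  show "laplacian_matrix G \<in> carrier_mat n n" by (simp add: laplacian_matrix_def V)
  show "(laplacian_matrix G)\<^sup>T = laplacian_matrix G"
    unfolding L by (rule stiffness_matrix_symmetric)
qed

section \<open>Displacement fields in a principal frame\<close>

text \<open>
  The frame \<open>e\<close> consists of the principal axes of the point set, that is, of the eigenvectors of
  its scatter matrix, and \<open>g a i\<close> is the coordinate of point \<open>i\<close> along \<open>e a\<close>, measured from the
  centroid. Being eigenvectors makes distinct coordinate functions \<open>g a\<close> orthogonal in \<open>\<real>\<^sup>n\<close>,
  and centring makes them orthogonal to the constants. The eigenvalue of \<open>e a\<close> is the sum of the
  squares \<open>(g a i)\<^sup>2\<close>, so sorting puts the axes on which all points have the same coordinate first.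
\<close>

lemma principal_frame:
  fixes P :: "nat \<Rightarrow> real vec"
  assumes P: "\<And>i. P i \<in> carrier_vec d" and n: "n > 0"
  obtains e g where
    "\<And>a. a < d \<Longrightarrow> e a \<in> carrier_vec d"
    "\<And>a b. a < d \<Longrightarrow> b < d \<Longrightarrow> e a \<bullet> e b = (if a = b then 1 else 0)"
    "\<And>y. y \<in> carrier_vec d \<Longrightarrow> (\<Sum>a<d. (e a \<bullet> y)\<^sup>2) = y \<bullet> y"
    "\<And>a i j. a < d \<Longrightarrow> e a \<bullet> (P i - P j) = g a i - g a j"
    "\<And>a. a < d \<Longrightarrow> (\<Sum>i<n. g a i) = (0 :: real)"
    "\<And>a b. a < d \<Longrightarrow> b < d \<Longrightarrow> a \<noteq> b \<Longrightarrow> (\<Sum>i<n. g a i * g b i) = 0"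
    "\<And>a b. a \<le> b \<Longrightarrow> b < d \<Longrightarrow> (\<Sum>i<n. (g a i)\<^sup>2) \<le> (\<Sum>i<n. (g b i)\<^sup>2)"
proof -
  define m where "m = vec d (\<lambda>a. (\<Sum>i<n. P i $ a) / n)"
  have m: "m \<in> carrier_vec d" by (simp add: m_def)
  define M where "M = mat d d (\<lambda>(a, b). \<Sum>i<n. (P i - m) $ a * (P i - m) $ b)"
  have M: "M \<in> carrier_mat d d" by (simp add: M_def)
  have MT: "M\<^sup>T = M" by (rule eq_matI) (auto simp: M_def mult.commute)
  obtain e \<mu> where e: "\<And>a. a < d \<Longrightarrow> e a \<in> carrier_vec d"
    "\<And>a. a < d \<Longrightarrow> M *\<^sub>v e a = \<mu> a \<cdot>\<^sub>v e a"
    "\<And>a b. a < d \<Longrightarrow> b < d \<Longrightarrow> e a \<bullet> e b = (if a = b then 1 else 0)"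
    and sorted: "\<And>a b. a \<le> b \<Longrightarrow> b < d \<Longrightarrow> \<mu> a \<le> \<mu> b"
    using sorted_orthonormal_eigenbasis[OF M MT] by blast
  define g where "g a i = e a \<bullet> (P i - m)" for a i
  have Mform: "x \<bullet> (M *\<^sub>v y) = (\<Sum>i<n. (x \<bullet> (P i - m)) * (y \<bullet> (P i - m)))"
    if x: "x \<in> carrier_vec d" and y: "y \<in> carrier_vec d" for x y
  proof -
    have "x \<bullet> (M *\<^sub>v y) = (\<Sum>a<d. \<Sum>b<d. \<Sum>i<n. x $ a * (P i - m) $ a * (y $ b * (P i - m) $ b))"
      using x y P m by (simp add: M_def scalar_prod_def atLeast0LessThan sum_distrib_left sum_distrib_right mult_ac)
    also have "\<dots> = (\<Sum>a<d. \<Sum>i<n. \<Sum>b<d. x $ a * (P i - m) $ a * (y $ b * (P i - m) $ b))"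
      by (intro sum.cong refl sum.swap)
    also have "\<dots> = (\<Sum>i<n. \<Sum>a<d. \<Sum>b<d. x $ a * (P i - m) $ a * (y $ b * (P i - m) $ b))"
      by (rule sum.swap)
    also have "\<dots> = (\<Sum>i<n. (x \<bullet> (P i - m)) * (y \<bullet> (P i - m)))"
      using m by (simp add: scalar_prod_def atLeast0LessThan sum_product)
    finally show ?thesis .
  qed
  have gg: "(\<Sum>i<n. g a i * g b i) = (if a = b then \<mu> b else 0)" if "a < d" "b < d" for a b
    using Mform[OF e(1)[OF that(1)] e(1)[OF that(2)]] that e(1)[OF that(1)] e(1)[OF that(2)]
      e(2)[OF that(2)] e(3)[OF that] by (simp add: g_def split: if_splits)
  show ?thesis
  proof (rule that[of e g])
    fix a assume a: "a < d"
    show "e a \<bullet> (P i - P j) = g a i - g a j" for i j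
      using e(1)[OF a] P m by (simp add: g_def scalar_prod_minus_distrib[where n = d])
    have "(\<Sum>i<n. g a i) = (\<Sum>i<n. \<Sum>b<d. e a $ b * (P i $ b - m $ b))"
      using m by (simp add: g_def scalar_prod_def atLeast0LessThan)
    also have "\<dots> = (\<Sum>b<d. e a $ b * (\<Sum>i<n. P i $ b - m $ b))"
      by (subst sum.swap) (simp add: sum_distrib_left)
    also have "\<dots> = 0"
      using n by (intro sum.neutral) (simp add: sum_subtractf m_def)
    finally show "(\<Sum>i<n. g a i) = 0" .
  next
    fix a b assume "a \<le> b" "b < d"
    thus "(\<Sum>i<n. (g a i)\<^sup>2) \<le> (\<Sum>i<n. (g b i)\<^sup>2)"
      using gg[of a a] gg[of b b] sorted[of a b] by (simp add: power2_eq_square)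
  next
    fix y :: "real vec" assume "y \<in> carrier_vec d"
    thus "(\<Sum>a<d. (e a \<bullet> y)\<^sup>2) = y \<bullet> y"
      using quadratic_form_eigenbasis(1)[where u = e and e = \<mu>, OF M e, of y] by simp
  qed (use e gg in auto)
qed

text \<open>
  The displacement field whose component along the axis \<open>e a\<close> is the function \<open>X a\<close> of the
  vertices, in the block order of realizations.
\<close>

definition frame_field :: "nat \<Rightarrow> nat \<Rightarrow> (nat \<Rightarrow> real vec) \<Rightarrow> (nat \<Rightarrow> nat \<Rightarrow> real) \<Rightarrow> real vec" where
  "frame_field d n e X = vec (d * n) (\<lambda>k. \<Sum>a<d. X a (k div d) * e a $ (k mod d))"

lemma frame_field_carrier: "frame_field d n e X \<in> carrier_vec (d * n)"
  by (simp add: frame_field_def)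

lemma frame_field_scalar_prod:
  assumes e: "\<And>a. a < d \<Longrightarrow> e a \<in> carrier_vec d"
    "\<And>a b. a < d \<Longrightarrow> b < d \<Longrightarrow> e a \<bullet> e b = (if a = b then 1 else 0)"
  shows "frame_field d n e X \<bullet> frame_field d n e Y = (\<Sum>a<d. \<Sum>i<n. X a i * Y a i)"
proof -
  have "frame_field d n e X \<bullet> frame_field d n e Y
      = (\<Sum>k<d * n. (\<Sum>a<d. X a (k div d) * e a $ (k mod d)) * (\<Sum>b<d. Y b (k div d) * e b $ (k mod d)))"
    by (simp add: frame_field_def scalar_prod_def atLeast0LessThan)
  also have "\<dots> = (\<Sum>i<n. \<Sum>k<d. (\<Sum>a<d. X a i * e a $ k) * (\<Sum>b<d. Y b i * e b $ k))"
    by (rule sum_div_mod)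
  also have "\<dots> = (\<Sum>i<n. \<Sum>a<d. X a i * Y a i)"
  proof (rule sum.cong[OF refl])
    fix i
    have "(\<Sum>k<d. (\<Sum>a<d. X a i * e a $ k) * (\<Sum>b<d. Y b i * e b $ k))
        = (\<Sum>k<d. \<Sum>a<d. \<Sum>b<d. X a i * Y b i * (e a $ k * e b $ k))"
      by (simp add: sum_product mult_ac)
    also have "\<dots> = (\<Sum>a<d. \<Sum>k<d. \<Sum>b<d. X a i * Y b i * (e a $ k * e b $ k))"
      by (rule sum.swap)
    also have "\<dots> = (\<Sum>a<d. \<Sum>b<d. \<Sum>k<d. X a i * Y b i * (e a $ k * e b $ k))"
      by (intro sum.cong refl sum.swap)
    also have "\<dots> = (\<Sum>a<d. \<Sum>b<d. X a i * Y b i * (e a \<bullet> e b))"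
    proof (intro sum.cong refl)
      fix a b assume "b \<in> {..<d}"
      hence "e a \<bullet> e b = (\<Sum>k<d. e a $ k * e b $ k)"
        using e(1)[of b] by (simp add: scalar_prod_def atLeast0LessThan)
      thus "(\<Sum>k<d. X a i * Y b i * (e a $ k * e b $ k)) = X a i * Y b i * (e a \<bullet> e b)"
        by (simp add: sum_distrib_left)
    qed
    also have "\<dots> = (\<Sum>a<d. \<Sum>b<d. if a = b then X a i * Y a i else 0)"
      using e(2) by (intro sum.cong refl) auto
    also have "\<dots> = (\<Sum>a<d. X a i * Y a i)"
      by (intro sum.cong refl) simp
    finally show "(\<Sum>k<d. (\<Sum>a<d. X a i * e a $ k) * (\<Sum>b<d. Y b i * e b $ k)) = (\<Sum>a<d. X a i * Y a i)" .
  qed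
  also have "\<dots> = (\<Sum>a<d. \<Sum>i<n. X a i * Y a i)" by (rule sum.swap)
  finally show ?thesis .
qed

lemma edge_row_frame_field:
  assumes e: "\<And>a. a < d \<Longrightarrow> e a \<in> carrier_vec d" and i: "i < n" and j: "j < n"
  shows "edge_row d n p (i, j) \<bullet> frame_field d n e X
    = (\<Sum>a<d. (X a i - X a j) * (e a \<bullet> bearing d p i j))"
proof -
  define b where "b = bearing d p i j"
  have b: "b \<in> carrier_vec d" unfolding b_def by (rule dim_bearing)
  define f where "f l = (if l = i then 1 else 0) - (if l = j then 1 else 0 :: real)" for l :: nat
  have f: "(\<Sum>l<n. f l * h l) = h i - h j" for h
  proof -
    have "(\<Sum>l<n. f l * h l) = (\<Sum>l<n. (if l = i then h l else 0) - (if l = j then h l else 0))"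
      by (intro sum.cong) (auto simp: f_def)
    thus ?thesis using i j by (simp add: sum_subtractf)
  qed
  have "edge_row d n p (i, j) \<bullet> frame_field d n e X
      = (\<Sum>k<d * n. f (k div d) * b $ (k mod d) * (\<Sum>a<d. X a (k div d) * e a $ (k mod d)))"
  proof -
    have "edge_row d n p (i, j) $ k = f (k div d) * b $ (k mod d)" if "k < d * n" for k
    proof -
      have "k div d < n" using that by (simp add: less_mult_imp_div_less mult.commute)
      thus ?thesis using that b i j
        by (simp add: edge_row_def kronecker_vec_def b_def[symmetric] f_def mult.commute unit_vec_def)
    qed
    thus ?thesis by (simp add: scalar_prod_def frame_field_def atLeast0LessThan)
  qed
  also have "\<dots> = (\<Sum>l<n. \<Sum>k<d. f l * b $ k * (\<Sum>a<d. X a l * e a $ k))"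
    by (rule sum_div_mod)
  also have "\<dots> = (\<Sum>l<n. f l * (\<Sum>k<d. \<Sum>a<d. X a l * (e a $ k * b $ k)))"
    by (simp add: sum_distrib_left mult_ac)
  also have "\<dots> = (\<Sum>l<n. f l * (\<Sum>a<d. X a l * (e a \<bullet> b)))"
    using b by (subst sum.swap) (simp add: scalar_prod_def atLeast0LessThan sum_distrib_left)
  also have "\<dots> = (\<Sum>a<d. (X a i - X a j) * (e a \<bullet> b))"
    unfolding f by (simp add: sum_subtractf left_diff_distrib)
  finally show ?thesis by (simp add: b_def)
qed

lemma card_increasing_pairs: "card {(a, b). a < b \<and> b < (N::nat)} = N choose 2"
proof (induction N)
  case (Suc N)
  have "{(a, b). a < b \<and> b < Suc N} = {(a, b). a < b \<and> b < N} \<union> (\<lambda>a. (a, N)) ` {..<N}"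
    by (auto simp: less_Suc_eq)
  moreover have "finite {(a, b). a < b \<and> b < N}"
    by (rule finite_subset[of _ "{..<N} \<times> {..<N}"]) auto
  moreover have "card ((\<lambda>a. (a, N)) ` {..<N}) = N"
    by (subst card_image) (auto simp: inj_on_def)
  ultimately have "card {(a, b). a < b \<and> b < Suc N} = (N choose 2) + N"
    using Suc.IH by (subst \<open>_ = _ \<union> _\<close>, subst card_Un_disjoint) auto
  thus ?case by (simp add: numeral_2_eq_2)
qed (simp add: numeral_2_eq_2)

text \<open>
  The Cauchy-Schwarz inequality for a vector \<open>\<beta>\<close> of length at most one, from the nonnegativity of
  \<open>\<Sum>(U a - s * \<beta> a)\<^sup>2\<close> with \<open>s = \<Sum>U a * \<beta> a\<close>.
\<close>

lemma sum_mult_square_le: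
  fixes U \<beta> :: "'a \<Rightarrow> real"
  assumes "(\<Sum>a\<in>A. (\<beta> a)\<^sup>2) \<le> 1"
  shows "(\<Sum>a\<in>A. U a * \<beta> a)\<^sup>2 \<le> (\<Sum>a\<in>A. (U a)\<^sup>2)"
proof -
  define s where "s = (\<Sum>a\<in>A. U a * \<beta> a)"
  have "0 \<le> (\<Sum>a\<in>A. (U a - s * \<beta> a)\<^sup>2)" by (intro sum_nonneg) simp
  also have "\<dots> = (\<Sum>a\<in>A. (U a)\<^sup>2 - 2 * s * (U a * \<beta> a) + s\<^sup>2 * (\<beta> a)\<^sup>2)"
    by (intro sum.cong refl) (simp add: power2_eq_square algebra_simps)
  also have "\<dots> = (\<Sum>a\<in>A. (U a)\<^sup>2) - 2 * s * s + s\<^sup>2 * (\<Sum>a\<in>A. (\<beta> a)\<^sup>2)"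
    by (simp only: sum.distrib sum_subtractf sum_distrib_left[symmetric] s_def[symmetric])
  also have "\<dots> \<le> (\<Sum>a\<in>A. (U a)\<^sup>2) - 2 * s * s + s\<^sup>2"
    using mult_left_mono[OF assms, of "s\<^sup>2"] by simp
  finally show ?thesis by (simp add: s_def power2_eq_square)
qed

text \<open>
  The components of the energy-free test field attached to a pair \<open>a < b \<le> d\<close>. If \<open>g a\<close> is not
  identically zero, it is the rotation in the plane of the axes \<open>a\<close> and \<open>b\<close> for \<open>b < d\<close> and,
  with \<open>g d\<close> the constant \<open>1\<close>, the translation along the axis \<open>a\<close> for \<open>b = d\<close>. The
  translation has only one component since components with index \<open>c = d\<close> are never used. If
  \<open>g a\<close> vanishes identically, only the vertex \<open>b\<close> moves, along the axis \<open>a\<close>.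
\<close>

definition motion :: "nat \<Rightarrow> (nat \<Rightarrow> nat \<Rightarrow> real) \<Rightarrow> nat \<times> nat \<Rightarrow> nat \<Rightarrow> nat \<Rightarrow> real" where
  "motion n g = (\<lambda>(a, b) c i.
     if c = a then (if \<forall>l<n. g a l = 0 then (if i = b then 1 else 0) else g b i)
     else if c = b \<and> (\<exists>l<n. g a l \<noteq> 0) then - g a i
     else 0)"

text \<open>
  Coordinate functions in a principal frame, extended by the constant function \<open>g d\<close>. The
  condition \<open>mono\<close> says that the identically vanishing ones come first. The pair \<open>(a, a)\<close> is
  also admitted below when \<open>g a\<close> vanishes, because \<open>motion n g (0, 0)\<close> is then the spare
  field of the degenerate case.
\<close>

locale principal_coordinates =
  fixes d n :: nat and g :: "nat \<Rightarrow> nat \<Rightarrow> real"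
  assumes n: "n \<ge> d + 1"
    and orth: "\<And>a b. a \<le> d \<Longrightarrow> b \<le> d \<Longrightarrow> a \<noteq> b \<Longrightarrow> (\<Sum>i<n. g a i * g b i) = 0"
    and gd: "\<And>i. g d i = 1"
    and mono: "\<And>a b. a \<le> b \<Longrightarrow> b \<le> d \<Longrightarrow> \<exists>l<n. g a l \<noteq> 0 \<Longrightarrow> \<exists>l<n. g b l \<noteq> 0"
begin

lemma motion_pos:
  assumes "a < d" "a < b \<or> (\<forall>l<n. g a l = 0)" "b \<le> d"
  shows "(\<Sum>c<d. \<Sum>i<n. motion n g (a, b) c i * motion n g (a, b) c i) > 0"
proof (rule sum_pos2[of _ a])
  show "0 < (\<Sum>i<n. motion n g (a, b) a i * motion n g (a, b) a i)"
  proof (cases "\<forall>l<n. g a l = 0")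
    case True
    show ?thesis
      by (rule sum_pos2[of _ b]) (use assms n True in \<open>auto simp: motion_def\<close>)
  next
    case False
    then obtain l where l: "l < n" "g b l \<noteq> 0" using mono[of a b] assms by (meson less_imp_le)
    show ?thesis
      by (rule sum_pos2[of _ l]) (use l False in \<open>auto simp: motion_def zero_less_mult_iff\<close>)
  qed
qed (use assms in \<open>auto intro: sum_nonneg\<close>)

text \<open>
  The inner products vanish axis by axis, since two fields that share an axis have there two
  different coordinate functions up to sign, or the indicator functions of two different vertices,
  unless one component is zero. For the pairs \<open>(a, b)\<close> and \<open>(a', a)\<close> this uses \<open>mono\<close>: a rotation in the plane of \<open>a'\<close> and \<open>a\<close> with \<open>a' < a\<close> occurs only if
  \<open>g a'\<close>, and hence \<open>g a\<close>, does not vanish.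
\<close>

lemma motion_orth:
  assumes ab: "a < d" "a < b \<or> (\<forall>l<n. g a l = 0)" "b \<le> d" "a \<le> b"
    and ab': "a' < d" "a' < b' \<or> (\<forall>l<n. g a' l = 0)" "b' \<le> d" "a' \<le> b'"
    and ne: "(a, b) \<noteq> (a', b')"
  shows "(\<Sum>c<d. \<Sum>i<n. motion n g (a, b) c i * motion n g (a', b') c i) = 0"
proof -
  have half: "(\<Sum>i<n. motion n g (a, b) a i * motion n g (a', b') a i) = 0"
    if ab: "a < d" "a < b \<or> (\<forall>l<n. g a l = 0)" "b \<le> d" and ab': "a' \<le> b'" "b' \<le> d"
      and ne: "(a, b) \<noteq> (a', b')" for a b a' b'
  proof -
    consider "a' = a" | "a' \<noteq> a" "a \<noteq> b' \<or> (\<forall>l<n. g a' l = 0)" | "a' < a" "a = b'" "\<exists>l<n. g a' l \<noteq> 0"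
      using ab'(1) le_neq_implies_less by metis
    thus ?thesis
    proof cases
      case 1
      hence b: "b \<noteq> b'" using ne by simp
      show ?thesis
      proof (cases "\<forall>l<n. g a l = 0")
        case True
        thus ?thesis using 1 b by (intro sum.neutral) (simp add: motion_def)
      next
        case False
        hence "(\<forall>l<n. g a l = 0) = False" by simp
        thus ?thesis using 1 orth[OF ab(3) ab'(2) b] by (simp add: motion_def del: not_all)
      qed
    next
      case 2
      thus ?thesis by (auto simp: motion_def intro!: sum.neutral)
    next
      case 3
      have nonflat: "\<exists>l<n. g a l \<noteq> 0" using mono[of a' a] 3 ab by (meson less_imp_le)
      hence "a < b" using ab by auto
      hence "(\<Sum>i<n. g b i * g a' i) = 0" using orth[of b a'] 3 ab by simp
      moreover have "(\<forall>l<n. g a l = 0) = False" using nonflat by simp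
      ultimately show ?thesis using 3 by (simp add: motion_def sum_negf del: not_all)
    qed
  qed
  show ?thesis
  proof (rule sum.neutral, rule ballI)
    fix c
    consider "c = a" | "c = a'" | "c \<noteq> a" "c \<noteq> a'" by blast
    thus "(\<Sum>i<n. motion n g (a, b) c i * motion n g (a', b') c i) = 0"
    proof cases
      case 1
      thus ?thesis using half[OF ab(1-3) ab'(4,3) ne] by simp
    next
      case 2
      thus ?thesis using half[OF ab'(1-3) ab(4,3) ne[symmetric]] by (simp add: mult.commute)
    next
      case 3
      show ?thesis
      proof (cases "c = b \<and> c = b' \<and> (\<exists>l<n. g a l \<noteq> 0) \<and> (\<exists>l<n. g a' l \<noteq> 0)")
        case True
        hence "(\<Sum>i<n. g a i * g a' i) = 0" using ne ab ab' by (intro orth) auto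
        thus ?thesis using 3 True by (simp add: motion_def)
      next
        case False
        thus ?thesis using 3 by (intro sum.neutral) (auto simp: motion_def)
      qed
    qed
  qed
qed

text \<open>
  Bearings have components proportional to \<open>g c i - g c j\<close>, so this is the first-order change of
  the length of the edge: the two terms of a rotation cancel, and translations do not contribute.
\<close>

lemma motion_strain:
  assumes ab: "a < d" "a < b \<or> (\<forall>l<n. g a l = 0)" "b \<le> d" and ij: "i < n" "j < n"
  shows "(\<Sum>c<d. (motion n g (a, b) c i - motion n g (a, b) c j) * (g c i - g c j)) = 0"
proof (cases "\<forall>l<n. g a l = 0")
  case True
  thus ?thesis using ij by (intro sum.neutral) (auto simp: motion_def)
next
  case False
  hence ne: "a \<noteq> b" using ab by auto
  let ?s = "(g b i - g b j) * (g a i - g a j)"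
  have "(\<Sum>c<d. (motion n g (a, b) c i - motion n g (a, b) c j) * (g c i - g c j))
      = (\<Sum>c<d. (if c = a then ?s else 0) - (if c = b then ?s else 0))"
    using False ne by (intro sum.cong refl) (auto simp: motion_def algebra_simps)
  also have "\<dots> = 0"
    using ab by (cases "b = d") (auto simp: sum_subtractf gd)
  finally show ?thesis .
qed

text \<open>
  The condition \<open>U\<close> says that the components of the field direction are proportional to
  the moments \<open>\<Sum>v\<^sub>i g\<^sub>a(i)\<close>; then the inner product with a rotation is \<open>U\<^sub>a V\<^sub>b - U\<^sub>b V\<^sub>a = 0\<close>,
  where \<open>V\<close> denotes the moments.
\<close>

lemma motion_orth_tensor:
  assumes ab: "a < b" "b \<le> d" and nonflat: "\<exists>l<n. g 0 l \<noteq> 0"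
    and v: "(\<Sum>i<n. v i) = 0"
    and U: "\<And>a b. a < d \<Longrightarrow> b < d \<Longrightarrow> U a * (\<Sum>i<n. v i * g b i) = U b * (\<Sum>i<n. v i * g a i)"
  shows "(\<Sum>c<d. \<Sum>i<n. U c * v i * motion n g (a, b) c i) = 0"
proof -
  have "\<exists>l<n. g a l \<noteq> 0" using mono[of 0 a] nonflat ab by auto
  hence nf: "(\<forall>l<n. g a l = 0) = False" "(\<exists>l<n. g a l \<noteq> 0) = True" by auto
  define V where "V a = (\<Sum>i<n. v i * g a i)" for a
  have "(\<Sum>i<n. U c * v i * motion n g (a, b) c i)
      = (if c = a then U a * V b else 0) - (if c = b then U b * V a else 0)" for c
    using ab by (simp add: motion_def nf V_def sum_distrib_left mult_ac sum_negf)
  hence "(\<Sum>c<d. \<Sum>i<n. U c * v i * motion n g (a, b) c i)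
      = (\<Sum>c<d. (if c = a then U a * V b else 0) - (if c = b then U b * V a else 0))"
    by simp
  also have "\<dots> = 0"
  proof (cases "b = d")
    case True
    have "V b = 0" using v by (simp add: V_def True gd)
    thus ?thesis using ab True by (simp add: sum_subtractf)
  next
    case False
    thus ?thesis using ab U[of a b] by (simp add: sum_subtractf V_def)
  qed
  finally show ?thesis .
qed

end

section \<open>Eigenvalue comparison\<close>

text \<open>
  The test fields are the motions of the pairs \<open>a < b \<le> d\<close> and one more field \<open>X\<close>: the spare
  field \<open>motion n g (0, 0)\<close> if all points have the same coordinate on some axis (then also on the
  first), and otherwise the product of the Fiedler vector \<open>v\<close> with the direction \<open>U\<close> of
  \<open>(\<Sum>i. v\<^sub>i p\<^sub>i)\<close>.
\<close>

lemma eigval_stiffness_le_alg_connectivity: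
  assumes G: "pair_graph G" and V: "pverts G = {0..<n}" and d: "d \<ge> 1" and n: "n \<ge> d + 1"
  shows "eigval (((d + 1) choose 2) + 1) (stiffness_matrix d G p) \<le> alg_connectivity G"
proof -
  have N: "num_verts G = n" by (simp add: V)
  have E: "i < n" "j < n" if "(i, j) \<in> edges G" for i j
    using that by (auto simp: edges_def N)
  define \<alpha> where "\<alpha> = alg_connectivity G"
  note L = laplacian_symmetric[OF G V]
  have \<alpha>0: "\<alpha> \<ge> 0"
    using eigval_nonneg[OF L, of 1] n d
    by (simp add: \<alpha>_def alg_connectivity_def numeral_2_eq_2 laplacian_quadratic_form[OF G V] sum_nonneg split_def)
  obtain v where v: "v \<in> carrier_vec n" "v \<bullet> v > 0" "v \<bullet> vec n (\<lambda>_. 1) = 0"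
      "v \<bullet> (laplacian_matrix G *\<^sub>v v) \<le> \<alpha> * (v \<bullet> v)"
    using eigval_2_test_vector[OF L, of "vec n (\<lambda>_. 1)"] n d by (auto simp: \<alpha>_def alg_connectivity_def)
  have vform: "(\<Sum>(i, j)\<in>edges G. (v $ i - v $ j)\<^sup>2) \<le> \<alpha> * (v \<bullet> v)"
    using v(4) by (simp add: laplacian_quadratic_form[OF G V v(1)])
  have v1: "(\<Sum>i<n. v $ i) = 0"
    using v(3) by (simp add: scalar_prod_def atLeast0LessThan)
  have vv: "v \<bullet> v = (\<Sum>i<n. v $ i * v $ i)"
    using v(1) by (simp add: scalar_prod_def atLeast0LessThan)

  define P where "P = position d p"
  have P: "P i \<in> carrier_vec d" for i by (simp add: P_def position_def)
  obtain e g0 where e: "\<And>a. a < d \<Longrightarrow> e a \<in> carrier_vec d"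
    "\<And>a b. a < d \<Longrightarrow> b < d \<Longrightarrow> e a \<bullet> e b = (if a = b then 1 else 0)"
    and parseval: "\<And>y. y \<in> carrier_vec d \<Longrightarrow> (\<Sum>a<d. (e a \<bullet> y)\<^sup>2) = y \<bullet> y"
    and diff: "\<And>a i j. a < d \<Longrightarrow> e a \<bullet> (P i - P j) = g0 a i - g0 a j"
    and centred: "\<And>a. a < d \<Longrightarrow> (\<Sum>i<n. g0 a i) = (0 :: real)"
    and orth0: "\<And>a b. a < d \<Longrightarrow> b < d \<Longrightarrow> a \<noteq> b \<Longrightarrow> (\<Sum>i<n. g0 a i * g0 b i) = 0"
    and mono0: "\<And>a b. a \<le> b \<Longrightarrow> b < d \<Longrightarrow> (\<Sum>i<n. (g0 a i)\<^sup>2) \<le> (\<Sum>i<n. (g0 b i)\<^sup>2)"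
  proof (rule principal_frame[of P d n, OF P])
    show "n > 0" using n by simp
  qed (rule that)
  \<comment> \<open>The constant function plays the part of a homogeneous coordinate, with translations as rotations.\<close>
  define g where "g a i = (if a = d then 1 else g0 a i)" for a i
  have dpos: "d > 0" using d by simp
  have orth: "(\<Sum>i<n. g a i * g b i) = 0" if "a \<le> d" "b \<le> d" "a \<noteq> b" for a b
  proof -
    consider "a = d" "b < d" | "b = d" "a < d" | "a < d" "b < d" using \<open>a \<le> d\<close> \<open>b \<le> d\<close> \<open>a \<noteq> b\<close> by linarith
    thus ?thesis
      by cases (use that orth0[of a b] centred[of a] centred[of b] in \<open>simp_all add: g_def\<close>)
  qed
  have gd: "g d i = 1" for i by (simp add: g_def)
  have mono: "\<exists>l<n. g b l \<noteq> 0" if ab: "a \<le> b" "b \<le> d" and nf: "\<exists>l<n. g a l \<noteq> 0" for a b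
  proof (cases "b = d")
    case True
    thus ?thesis using n by (auto simp: g_def intro!: exI[of _ 0])
  next
    case False
    obtain l where "l < n" "g0 a l \<noteq> 0" using nf False ab by (auto simp: g_def)
    hence "0 < (\<Sum>i<n. (g0 a i)\<^sup>2)" by (intro sum_pos2[of _ l]) auto
    also have "\<dots> \<le> (\<Sum>i<n. (g0 b i)\<^sup>2)" using mono0 False ab by simp
    finally have "(\<Sum>i<n. (g0 b i)\<^sup>2) \<noteq> 0" by simp
    moreover have "(\<Sum>i<n. (g0 b i)\<^sup>2) = 0" if "\<forall>l<n. g0 b l = 0"
      using that by (intro sum.neutral) simp
    ultimately have "\<exists>l<n. g0 b l \<noteq> 0" by blast
    thus ?thesis using False by (simp add: g_def)
  qed
  interpret principal_coordinates d n g
    by (unfold_locales) (fact n orth gd mono)+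

  define strain where "strain X = (\<lambda>(i, j). edge_row d n p (i, j) \<bullet> frame_field d n e X)" for X
  have bear: "\<exists>\<gamma>. (\<forall>a<d. e a \<bullet> bearing d p i j = \<gamma> * (g a i - g a j))
      \<and> (\<Sum>a<d. (\<gamma> * (g a i - g a j))\<^sup>2) \<le> 1" for i j
  proof -
    obtain \<gamma> where \<gamma>: "bearing d p i j = \<gamma> \<cdot>\<^sub>v (P i - P j)" "\<gamma>\<^sup>2 * ((P i - P j) \<bullet> (P i - P j)) \<le> 1"
      using bearing_scaled[of d p i j] unfolding P_def by blast
    have Pij: "P i - P j \<in> carrier_vec d" using P by simp
    have 1: "e a \<bullet> (P i - P j) = g a i - g a j" if "a < d" for a using diff[OF that] that by (simp add: g_def)
    have "e a \<bullet> bearing d p i j = \<gamma> * (g a i - g a j)" if "a < d" for a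
      using 1[OF that] e(1)[OF that] Pij by (simp add: \<gamma>(1))
    moreover have "(\<Sum>a<d. (\<gamma> * (g a i - g a j))\<^sup>2) = \<gamma>\<^sup>2 * ((P i - P j) \<bullet> (P i - P j))"
      unfolding parseval[OF Pij, symmetric] by (simp add: 1 power_mult_distrib sum_distrib_left)
    ultimately show ?thesis using \<gamma>(2) by auto
  qed
  have strain: "strain X (i, j) = (\<Sum>a<d. (X a i - X a j) * (e a \<bullet> bearing d p i j))"
    if "(i, j) \<in> edges G" for X i j
    unfolding strain_def using edge_row_frame_field[OF e(1) E[OF that]] by simp
  have strain_motion: "strain (motion n g (a, b)) ij = 0"
    if ab: "a < d" "a < b \<or> (\<forall>l<n. g a l = 0)" "b \<le> d" and ij: "ij \<in> edges G" for a b ij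
  proof -
    obtain i j where ij': "ij = (i, j)" by (cases ij)
    obtain \<gamma> where \<gamma>: "\<And>a. a < d \<Longrightarrow> e a \<bullet> bearing d p i j = \<gamma> * (g a i - g a j)" using bear by blast
    have "strain (motion n g (a, b)) ij
        = \<gamma> * (\<Sum>c<d. (motion n g (a, b) c i - motion n g (a, b) c j) * (g c i - g c j))"
      using strain ij unfolding ij' by (simp add: \<gamma> sum_distrib_left mult_ac)
    thus ?thesis using motion_strain[OF ab] E ij unfolding ij' by simp
  qed

  obtain X where X_pos: "(\<Sum>c<d. \<Sum>i<n. X c i * X c i) > 0"
    and X_orth: "\<And>a b. a < b \<Longrightarrow> b \<le> d \<Longrightarrow> (\<Sum>c<d. \<Sum>i<n. X c i * motion n g (a, b) c i) = 0"
    and X_form: "(\<Sum>ij\<in>edges G. (strain X ij)\<^sup>2) \<le> \<alpha> * (\<Sum>c<d. \<Sum>i<n. X c i * X c i)"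
  proof (cases "\<forall>l<n. g 0 l = 0")
    case True
    show ?thesis
    proof (rule that[of "motion n g (0, 0)"])
      show pos: "(\<Sum>c<d. \<Sum>i<n. motion n g (0, 0) c i * motion n g (0, 0) c i) > 0"
        using motion_pos[of 0 0] dpos True by simp
      show "(\<Sum>ij\<in>edges G. (strain (motion n g (0, 0)) ij)\<^sup>2)
          \<le> \<alpha> * (\<Sum>c<d. \<Sum>i<n. motion n g (0, 0) c i * motion n g (0, 0) c i)"
        using strain_motion[of 0 0] True dpos \<alpha>0 pos by (simp add: less_imp_le)
      fix a b assume ab: "a < b" "b \<le> d"
      show "(\<Sum>c<d. \<Sum>i<n. motion n g (0, 0) c i * motion n g (a, b) c i) = 0"
        using motion_orth[of 0 0 a b] ab True dpos by auto
    qed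
  next
    case False
    define V where "V a = (\<Sum>i<n. v $ i * g a i)" for a
    \<comment> \<open>If all moments vanish, every direction is orthogonal to the rotations; the first axis is chosen.\<close>
    define U where "U a = (if \<forall>b<d. V b = 0 then (if a = 0 then 1 else 0) else V a)" for a
    have U2: "(\<Sum>a<d. (U a)\<^sup>2) > 0"
    proof (cases "\<forall>b<d. V b = 0")
      case True
      thus ?thesis using dpos by (intro sum_pos2[of _ 0]) (auto simp: U_def)
    next
      case False
      then obtain b where "b < d" "V b \<noteq> 0" by blast
      thus ?thesis using False by (intro sum_pos2[of _ b]) (auto simp: U_def)
    qed
    define X where "X c i = U c * v $ i" for c i
    have XX: "(\<Sum>c<d. \<Sum>i<n. X c i * X c i) = (\<Sum>a<d. (U a)\<^sup>2) * (v \<bullet> v)"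
      unfolding vv sum_product by (simp add: X_def power2_eq_square mult_ac)
    show ?thesis
    proof (rule that[of X])
      show "(\<Sum>c<d. \<Sum>i<n. X c i * X c i) > 0" unfolding XX using U2 v(2) by simp
      show "(\<Sum>c<d. \<Sum>i<n. X c i * motion n g (a, b) c i) = 0" if "a < b" "b \<le> d" for a b
        unfolding X_def using False v1 that
        by (intro motion_orth_tensor) (auto simp: U_def V_def)
      have "(\<Sum>ij\<in>edges G. (strain X ij)\<^sup>2)
          \<le> (\<Sum>(i, j)\<in>edges G. (\<Sum>a<d. (U a)\<^sup>2) * (v $ i - v $ j)\<^sup>2)"
      proof (rule sum_mono, clarify)
        fix i j assume ij: "(i, j) \<in> edges G"
        obtain \<gamma> where \<gamma>: "\<And>a. a < d \<Longrightarrow> e a \<bullet> bearing d p i j = \<gamma> * (g a i - g a j)"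
          "(\<Sum>a<d. (\<gamma> * (g a i - g a j))\<^sup>2) \<le> 1" using bear by blast
        have "strain X (i, j) = (v $ i - v $ j) * (\<Sum>a<d. U a * (\<gamma> * (g a i - g a j)))"
          unfolding strain[OF ij] sum_distrib_left
          by (intro sum.cong refl) (simp add: \<gamma>(1) X_def algebra_simps)
        hence "(strain X (i, j))\<^sup>2 = (v $ i - v $ j)\<^sup>2 * (\<Sum>a<d. U a * (\<gamma> * (g a i - g a j)))\<^sup>2"
          by (simp add: power_mult_distrib)
        also have "\<dots> \<le> (v $ i - v $ j)\<^sup>2 * (\<Sum>a<d. (U a)\<^sup>2)"
          by (intro mult_left_mono sum_mult_square_le \<gamma>(2)) simp
        finally show "(strain X (i, j))\<^sup>2 \<le> (\<Sum>a<d. (U a)\<^sup>2) * (v $ i - v $ j)\<^sup>2"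
          by (simp add: mult.commute)
      qed
      also have "\<dots> = (\<Sum>a<d. (U a)\<^sup>2) * (\<Sum>(i, j)\<in>edges G. (v $ i - v $ j)\<^sup>2)"
        by (simp add: sum_distrib_left split_def)
      also have "\<dots> \<le> (\<Sum>a<d. (U a)\<^sup>2) * (\<alpha> * (v \<bullet> v))"
        using U2 by (intro mult_left_mono vform) simp
      finally show "(\<Sum>ij\<in>edges G. (strain X ij)\<^sup>2) \<le> \<alpha> * (\<Sum>c<d. \<Sum>i<n. X c i * X c i)"
        unfolding XX by (simp add: mult_ac)
    qed
  qed

  define k where "k = (d + 1) choose 2"
  have "finite {(a, b). a < b \<and> b < d + 1}"
    by (rule finite_subset[of _ "{..<d + 1} \<times> {..<d + 1}"]) auto
  then obtain h where h: "bij_betw h {..<k} {(a, b). a < b \<and> b < d + 1}"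
    using ex_bij_betw_nat_finite[of "{(a, b). a < b \<and> b < d + 1}"] card_increasing_pairs[of "d + 1"]
    by (auto simp: k_def atLeast0LessThan)
  define Y where "Y i = (if i < k then motion n g (h i) else X)" for i
  have hi: "\<exists>a b. h i = (a, b) \<and> a < b \<and> a < d \<and> b \<le> d" if "i < k" for i
    using bij_betwE[OF h] that by fastforce
  have hne: "h i \<noteq> h j" if "i < k" "j < k" "i \<noteq> j" for i j
    using bij_betw_imp_inj_on[OF h] that by (auto simp: inj_on_def)
  have Ystrain: "strain (Y i) ij = 0" if i: "i < k" and ij: "ij \<in> edges G" for i ij
  proof -
    obtain a b where ab: "h i = (a, b)" "a < b" "a < d" "b \<le> d" using hi[OF i] by blast
    thus ?thesis using strain_motion[OF ab(3) _ ab(4) ij] i by (simp add: Y_def)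
  qed
  have Yorth: "(\<Sum>c<d. \<Sum>l<n. Y i c l * Y j c l) = 0" if ij: "i \<le> k" "j \<le> k" "i \<noteq> j" for i j
  proof -
    have *: "(\<Sum>c<d. \<Sum>l<n. Y i c l * Y j c l) = 0" if ij: "i \<le> k" "j < k" "i \<noteq> j" for i j
    proof (cases "i < k")
      case True
      obtain a b where ab: "h i = (a, b)" "a < b" "a < d" "b \<le> d" using hi[OF True] by blast
      obtain a' b' where ab': "h j = (a', b')" "a' < b'" "a' < d" "b' \<le> d" using hi[OF ij(2)] by blast
      have "(a, b) \<noteq> (a', b')" using hne[OF True ij(2,3)] ab(1) ab'(1) by simp
      thus ?thesis using motion_orth[of a b a' b'] ab ab' True ij(2) by (simp add: Y_def)
    next
      case False
      obtain a b where "h j = (a, b)" "a < b" "a < d" "b \<le> d" using hi[OF ij(2)] by blast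
      thus ?thesis using False X_orth[of a b] ij(2) by (simp add: Y_def)
    qed
    show ?thesis
    proof (cases "j < k")
      case True
      thus ?thesis using * ij by simp
    next
      case False
      hence "i < k" using ij by simp
      hence "(\<Sum>c<d. \<Sum>l<n. Y j c l * Y i c l) = 0" using *[of j i] ij by simp
      thus ?thesis by (simp add: mult.commute)
    qed
  qed
  have Ypos: "(\<Sum>c<d. \<Sum>l<n. Y i c l * Y i c l) > 0" for i
  proof (cases "i < k")
    case True
    obtain a b where ab: "h i = (a, b)" "a < b" "a < d" "b \<le> d" using hi[OF True] by blast
    thus ?thesis using motion_pos[OF ab(3) _ ab(4)] True by (simp add: Y_def)
  next
    case False
    thus ?thesis using X_pos by (simp add: Y_def)
  qed

  define w where "w i = frame_field d n e (Y i)" for i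
  have w: "w i \<in> carrier_vec (d * n)" for i unfolding w_def by (rule frame_field_carrier)
  have ww: "w i \<bullet> w j = (\<Sum>c<d. \<Sum>l<n. Y i c l * Y j c l)" for i j
    unfolding w_def by (rule frame_field_scalar_prod[OF e])
  define S where "S = stiffness_matrix d G p"
  have S: "S \<in> carrier_mat (d * n) (d * n)" "S\<^sup>T = S"
    using stiffness_matrix_carrier[of d G p] stiffness_matrix_symmetric[of d G p] by (auto simp: S_def N)
  have wSw: "w i \<bullet> (S *\<^sub>v w j) = (\<Sum>ij\<in>edges G. strain (Y i) ij * strain (Y j) ij)" for i j
    using stiffness_matrix_bilinear[of "w i" d G "w j" p] w
    by (simp add: S_def N strain_def w_def split_def)
  have "eigval (Suc k) S \<le> \<alpha>"
  proof (rule eigval_le_if_orthogonal_test_vectors[OF S _ w])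
    have "2 * k = (d + 1) * d" by (simp add: k_def choose_two)
    moreover have "(d + 1) * d \<le> n * d" using n by (rule mult_right_mono) simp
    ultimately have "2 * k \<le> d * n" by (simp add: mult.commute)
    moreover have "k > 0" using d by (simp add: k_def zero_less_binomial_iff)
    ultimately show "k < d * n" by linarith
  next
    fix i j assume ij: "i \<le> k" "j \<le> k" "i \<noteq> j"
    show "w i \<bullet> w j = 0" unfolding ww by (rule Yorth[OF ij])
    have "i < k \<or> j < k" using ij by linarith
    thus "w i \<bullet> (S *\<^sub>v w j) = 0" unfolding wSw using Ystrain by (intro sum.neutral) auto
  next
    fix i assume i: "i \<le> k"
    show "w i \<bullet> w i > 0" unfolding ww by (rule Ypos)
    show "w i \<bullet> (S *\<^sub>v w i) \<le> \<alpha> * (w i \<bullet> w i)"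
    proof (cases "i < k")
      case True
      have "0 \<le> \<alpha> * (w i \<bullet> w i)" using \<alpha>0 by (simp add: scalar_prod_self_nonneg)
      thus ?thesis unfolding wSw using Ystrain[OF True] by simp
    next
      case False
      thus ?thesis unfolding wSw ww using X_form by (simp add: Y_def power2_eq_square)
    qed
  qed
  thus ?thesis by (simp add: S_def \<alpha>_def k_def)
qed

text \<open>
  The bound is applied twice: in dimension \<open>d\<close>, and in dimension one, where distinct points on the
  line attain it because \<open>((1 + 1) choose 2) + 1 = 2\<close>.
\<close>

theorem theorem4:
  fixes d n :: nat and G :: "nat pair_pre_digraph"
  assumes "d \<ge> 2"
    and "pair_graph G"
    and "pverts G = {0..<n}"
    and "Digraph_Component.connected (with_proj G)"
    and "n \<ge> d + 1"
  shows "gen_alg_connectivity d G \<le> gen_alg_connectivity 1 G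
    \<and> gen_alg_connectivity 1 G = alg_connectivity G"
proof -
  note G = assms(2) and V = assms(3)
  have upper: "gen_alg_connectivity d' G \<le> alg_connectivity G" if "1 \<le> d'" "d' + 1 \<le> n" for d'
    unfolding gen_alg_connectivity_def
  proof (rule cSup_least)
    show "{eigval (((d' + 1) choose 2) + 1) (stiffness_matrix d' G p) |p. p \<in> carrier_vec (d' * num_verts G)} \<noteq> {}"
      using zero_carrier_vec by blast
  qed (use eigval_stiffness_le_alg_connectivity[OF G V that] in auto)
  define p where "p = vec n real"
  have "inj_on (\<lambda>i. p $ i) {..<n}" by (auto simp: inj_on_def p_def)
  hence L: "laplacian_matrix G = stiffness_matrix 1 G p"
    by (rule laplacian_eq_stiffness_matrix[OF G V])
  have "gen_alg_connectivity 1 G = alg_connectivity G"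
    unfolding gen_alg_connectivity_def
  proof (rule cSup_eq_maximum)
    show "alg_connectivity G \<in> {eigval (((1 + 1) choose 2) + 1) (stiffness_matrix 1 G p) |p. p \<in> carrier_vec (1 * num_verts G)}"
      unfolding alg_connectivity_def L using V
      by (auto simp: p_def numeral_2_eq_2 intro!: exI[of _ p])
  qed (use eigval_stiffness_le_alg_connectivity[OF G V, of 1] assms in auto)
  thus ?thesis using upper[of d] assms by simp
qed

end
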